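(* $\displaystyle \mathrm{m}_{\mathbb{D}} (\sqrt{2}+x+y)=\frac{L(\chi_{-4},2)}{\pi} + \mathcal{C}_{\sqrt{2}}+ \frac{3}{8}-\frac{3}{2\pi}$, where $$\mathcal{C}_{\sqrt{2}} = \frac{\Gamma\left(\frac{3}{4}\right)^2}{\sqrt{2\pi^3}}\, {}_4F_3\!\left(\tfrac{1}{4}, \tfrac{1}{4}, \tfrac{3}{4}, \tfrac{3}{4}; \tfrac{1}{2}, \tfrac{5}{4}, \tfrac{5}{4}; 1\right) - \frac{\Gamma\left(\frac{1}{4}\right)^2}{72\sqrt{2\pi^3}}\, {}_4F_3\!\left(\tfrac{3}{4}, \tfrac{3}{4}, \tfrac{5}{4}, \tfrac{5}{4}; \tfrac{3}{2}, \tfrac{7}{4}, \tfrac{7}{4}; 1\right).$$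
   Context: For a nonzero rational function $P\in\mathbb{C}(x_1,\dots,x_n)$, the (logarithmic) areal Mahler measure is $\mathrm{m}_\mathbb{D}(P)=\frac{1}{\pi^n}\int_{\mathbb{D}^n}\log|P(x_1,\dots,x_n)|\,dA(x_1)\cdots dA(x_n)$, where $\mathbb{D}=\{x\in\mathbb{C}:|x|\le 1\}$ and $dA$ is Lebesgue (area) measure on $\mathbb{C}$. $L(\chi_{-4},s)$ is the Dirichlet $L$-function of the character $\chi_{-4}=\left(\frac{-4}{\cdot}\right)$ of conductor 4 (so $L(\chi_{-4},2)$ is Catalan's constant). The generalized hypergeometric function is ${}_pF_q(a_1,\dots,a_p;b_1,\dots,b_q;z)=\sum_{n\ge0}\frac{(a_1)_n\cdots(a_p)_n}{(b_1)_n\cdots(b_q)_n}\frac{z^n}{n!}$ with Pochhammer symbol $(a)_0=1$, $(a)_n=a(a+1)\cdots(a+n-1)$. *)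

theory Defs
  imports "HOL-Analysis.Analysis"
begin

definition areal_mahler2 :: "(complex \<Rightarrow> complex \<Rightarrow> complex) \<Rightarrow> real" where
  "areal_mahler2 P =
     (1 / pi ^ 2) * (\<integral>z \<in> cball (0::complex) 1 \<times> cball (0::complex) 1.
                         ln (cmod (P (fst z) (snd z))) \<partial>lborel)"

definition chi_m4 :: "nat \<Rightarrow> real" where
  "chi_m4 n = (if n mod 4 = 1 then 1 else if n mod 4 = 3 then -1 else 0)"

definition L_chi_m4 :: "real \<Rightarrow> real" where
  "L_chi_m4 s = (\<Sum>n. chi_m4 (Suc n) / (real (Suc n)) powr s)"

definition hypergeom :: "real list \<Rightarrow> real list \<Rightarrow> real \<Rightarrow> real" where
  "hypergeom as bs z =
     (\<Sum>n. (\<Prod>a\<leftarrow>as. pochhammer a n) / (\<Prod>b\<leftarrow>bs. pochhammer b n) * z ^ n / fact n)"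

definition C_sqrt2 :: real where
  "C_sqrt2 =
     Gamma (3/4) ^ 2 / sqrt (2 * pi ^ 3)
       * hypergeom [1/4, 1/4, 3/4, 3/4] [1/2, 5/4, 5/4] 1
   - Gamma (1/4) ^ 2 / (72 * sqrt (2 * pi ^ 3))
       * hypergeom [3/4, 3/4, 5/4, 5/4] [3/2, 7/4, 7/4] 1"

end

(* For |w| >= 1 the mean of ln |w + y| over the unit disc is ln |w|, and for |w| < 1 it is (|w|^2 - 1)/2;
   this reduces the double integral to one over the disc of radius 1 around sqrt 2. In polar
   coordinates around the origin, the ray at angle u meets this disc for exp (-h) <= r <= exp h, where
   sinh h = sqrt (cos (2 u)). The substitution sin p = sqrt 2 * sin u turns h into arsinh (cos p), and
   integration by parts removes everything except elementary terms and the two integrals over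
   [0, pi/2] of arsinh (cos p) and of arsinh (cos p) * cos p / sqrt (1 + cos^2 p). Termwise integration
   of the arsinh series gives Beta values: the first integral is L(chi_{-4}, 2), and the terms of even
   and odd index of the second are the two hypergeometric series. *)
theory Submission
  imports Defs
begin

section \<open>Termwise integration of the arsinh series\<close>

text \<open>The constant sqrt 2 is special because the unit circle around it has power 2 - 1 = 1
  with respect to the origin: the two distances at which a ray meets it are reciprocal, so ln r runs
  over a symmetric interval and the change of formula at r = 1 falls in its middle. The tangents
  from the origin have slopes 1 and -1. A ray is described by its slope t = tan u, so du becomes dt
  / (1 + t^2), cos (2 u) becomes (1 - t^2) / (1 + t^2), and the later substitution reads t = sin p /
  sqrt (1 + cos^2 p). Two hypergeometric series arise because the Beta argument moves by 1/2 from
  one term to the next, while the functional equation of Beta needs a move by 1. The delicate points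
  are the logarithmic singularity in the disc when |w| \<le> 1, met by comparing ln |w^M - y^M| with
  M ln (max |w| |y|) for growing M, and the endpoint p = 0, where the arsinh series is at the
  boundary of its disc of convergence.\<close>

lemma integral_sums:
  fixes f :: "nat \<Rightarrow> real \<Rightarrow> real"
  assumes ab: "a \<le> b" and "\<And>k. continuous_on {a..b} (f k)"
    and M: "\<And>k t. t \<in> {a..b} \<Longrightarrow> \<bar>f k t\<bar> \<le> M k" "summable M"
    and "finite N" and sums: "\<And>t. t \<in> {a..b} - N \<Longrightarrow> (\<lambda>k. f k t) sums F t"
  shows "(\<lambda>k. integral {a..b} (f k)) sums integral {a..b} F"
    and "summable (\<lambda>k. \<bar>integral {a..b} (f k)\<bar>)"
proof -
  have int: "f k integrable_on {a..b}" for k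
    using assms by (intro integrable_continuous_real)
  have "uniform_limit {a..b} (\<lambda>n t. \<Sum>k<n. f k t) (\<lambda>t. \<Sum>k. f k t) sequentially"
    using M by (intro Weierstrass_m_test) auto
  then obtain I J where IJ: "\<And>n. ((\<lambda>t. \<Sum>k<n. f k t) has_integral I n) {a..b}"
    "((\<lambda>t. \<Sum>k. f k t) has_integral J) {a..b}" "I \<longlonglongrightarrow> J"
    by (rule uniform_limit_integral) (auto intro!: continuous_on_sum assms)
  have "I = (\<lambda>n. \<Sum>k<n. integral {a..b} (f k))"
  proof
    show "I n = (\<Sum>k<n. integral {a..b} (f k))" for n
      using integral_unique[OF IJ(1)[of n]] integral_sum[of "{..<n}" f "{a..b}"] int by simp
  qed
  \<comment> \<open>The sum is identified with \<open>F\<close> only off \<open>N\<close>; a finite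
    set does not affect the integral.\<close>
  moreover have "(F has_integral J) {a..b}"
    by (rule has_integral_spike_finite[OF \<open>finite N\<close> _ IJ(2)]) (use sums in \<open>auto simp: sums_iff\<close>)
  ultimately show "(\<lambda>k. integral {a..b} (f k)) sums integral {a..b} F"
    using IJ(3) by (simp add: sums_def integral_unique)
  show "summable (\<lambda>k. \<bar>integral {a..b} (f k)\<bar>)"
  proof (rule summable_comparison_test')
    show "summable (\<lambda>k. M k * (b - a))" using M by (intro summable_mult2)
    show "norm \<bar>integral {a..b} (f k)\<bar> \<le> M k * (b - a)" for k
      using integral_bound[OF ab assms(2)[of k], of "M k"] M by simp
  qed
qed

text \<open>The number (1/2)_k / k! is binom(2k, k) / 4^k, so these are the absolute values of the
  Taylor coefficients of arsinh. The sign (-1)^k stays outside so that the same sequence serves as a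
  majorant.\<close>

definition arsinh_coeff :: "nat \<Rightarrow> real" where
  "arsinh_coeff k = pochhammer (1/2) k / fact k / (2 * real k + 1)"

lemma arsinh_coeff_nonneg: "arsinh_coeff k \<ge> 0"
  by (simp add: arsinh_coeff_def pochhammer_nonneg)

text \<open>By a Wallis-type estimate (1/2)_k / k! is O(k^(-1/2)), so the coefficients are
  O(k^(-3/2)). This makes the arsinh series converge uniformly up to the endpoint x = 1.\<close>

lemma summable_arsinh_coeff: "summable arsinh_coeff"
proof (rule summable_comparison_test')
  define c where "c k = pochhammer (1/2 :: real) k / fact k" for k
  have c0: "c k \<ge> 0" for k by (simp add: c_def pochhammer_nonneg)
  \<comment> \<open>The quantity starts at 1 and decreases: the ratio of consecutive values is
    (2k+1)(2k+3) / (2k+2)^2 < 1.\<close>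
  have c_sq: "(c k)\<^sup>2 * (2 * real k + 1) \<le> 1" for k
  proof (induction k)
    case (Suc k)
    have step: "c (Suc k) = c k * ((2 * real k + 1) / (2 * real k + 2))"
      by (simp add: c_def pochhammer_Suc field_simps)
    have "(c (Suc k))\<^sup>2 * (2 * real (Suc k) + 1)
        = ((c k)\<^sup>2 * (2 * real k + 1)) * ((2 * real k + 1) * (2 * real k + 3) / (2 * real k + 2)\<^sup>2)"
      unfolding step power_mult_distrib power_divide by (simp add: power2_eq_square)
    also have "\<dots> \<le> 1 * 1"
    proof (rule mult_mono)
      show "(2 * real k + 1) * (2 * real k + 3) / (2 * real k + 2)\<^sup>2 \<le> 1"
      proof -
        have "(2 * real k + 1) * (2 * real k + 3) \<le> (2 * real k + 2)\<^sup>2"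
          by (simp add: power2_eq_square algebra_simps)
        moreover have "(2 * real k + 2)\<^sup>2 > 0" by (intro zero_less_power) linarith
        ultimately show ?thesis by (simp only: divide_le_eq_1) simp
      qed
    qed (use Suc.IH in auto)
    finally show ?case by simp
  qed (simp add: c_def)
  have "summable (\<lambda>k. real k powr (-3/2))" by (simp add: summable_real_powr_iff)
  then show "summable (\<lambda>k. real (Suc k) powr (-3/2))" by (subst summable_Suc_iff)
  show "norm (arsinh_coeff k) \<le> real (Suc k) powr (-3/2)" for k
  proof -
    have "(c k)\<^sup>2 \<le> 1 / (2 * real k + 1)" using c_sq[of k] by (simp add: field_simps)
    also have "\<dots> \<le> 1 / real (Suc k)" by (intro divide_left_mono) auto
    finally have "c k \<le> sqrt (1 / real (Suc k))" by (rule real_le_rsqrt)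
    then have "c k \<le> real (Suc k) powr (-1/2)"
      by (simp add: powr_minus_divide powr_half_sqrt real_sqrt_divide)
    moreover have "1 / (2 * real k + 1) \<le> real (Suc k) powr (-1)"
      by (simp add: powr_minus_divide frac_le)
    ultimately have "c k * (1 / (2 * real k + 1)) \<le> real (Suc k) powr (-1/2) * real (Suc k) powr (-1)"
      by (intro mult_mono) auto
    also have "\<dots> = real (Suc k) powr (-3/2)" by (subst powr_add[symmetric]) simp
    finally show ?thesis using arsinh_coeff_nonneg[of k] by (simp add: arsinh_coeff_def c_def)
  qed
qed

text \<open>Termwise integration over [0, x] of the binomial series of (1 + t^2)^(-1/2). With x < 1
  the geometric series in x^2 is a majorant, since the binomial coefficients are at most 1 in
  absolute value.\<close>

lemma arsinh_sums:
  fixes x :: real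
  assumes x: "0 \<le> x" "x < 1"
  shows "(\<lambda>k. (-1) ^ k * arsinh_coeff k * x ^ (2 * k + 1)) sums arsinh x"
proof -
  define b where "b k = (-1) ^ k * (pochhammer (1/2 :: real) k / fact k)" for k
  have b1: "\<bar>b k\<bar> \<le> 1" for k
  proof -
    have "pochhammer (1/2 :: real) k \<le> fact k"
      unfolding pochhammer_fact by (auto simp: pochhammer_prod intro!: prod_mono)
    then show ?thesis by (simp add: b_def abs_mult pochhammer_nonneg)
  qed
  have "(\<lambda>k. integral {0..x} (\<lambda>t. b k * t ^ (2 * k))) sums integral {0..x} (\<lambda>t. 1 / sqrt (t\<^sup>2 + 1))"
  proof (rule integral_sums(1))
    show "\<bar>b k * t ^ (2 * k)\<bar> \<le> (x\<^sup>2) ^ k" if "t \<in> {0..x}" for t k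
    proof -
      have "\<bar>b k\<bar> * \<bar>t ^ (2 * k)\<bar> \<le> 1 * x ^ (2 * k)"
        using that b1[of k] by (intro mult_mono) (auto simp: power_abs intro!: power_mono)
      then show ?thesis by (simp add: abs_mult power_mult)
    qed
    show "summable (\<lambda>k. (x\<^sup>2) ^ k)" using x by (simp add: summable_geometric abs_square_less_1)
    show "(\<lambda>k. b k * t ^ (2 * k)) sums (1 / sqrt (t\<^sup>2 + 1))" if "t \<in> {0..x} - {}" for t
    proof -
      have "\<bar>t\<^sup>2\<bar> < 1" using that x by (simp add: abs_square_less_1)
      from gen_binomial_real[OF this, of "- 1 / 2"] show ?thesis
        by (simp add: gbinomial_pochhammer b_def power_mult powr_minus_divide powr_half_sqrt add.commute)
    qed
  qed (use x in \<open>auto intro!: continuous_intros\<close>)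
  moreover have "integral {0..x} (\<lambda>t. b k * t ^ (2 * k)) = (-1) ^ k * arsinh_coeff k * x ^ (2 * k + 1)" for k
  proof -
    have "((\<lambda>t. b k * t ^ (2 * k)) has_integral
        (b k / (2 * real k + 1) * x ^ (2 * k + 1) - b k / (2 * real k + 1) * 0 ^ (2 * k + 1))) {0..x}"
    proof (rule fundamental_theorem_of_calculus)
      fix t
      have "((\<lambda>t. b k / (2 * real k + 1) * t ^ (2 * k + 1)) has_real_derivative
          b k / (2 * real k + 1) * (real (2 * k + 1) * t ^ (2 * k))) (at t within {0..x})"
        using DERIV_cmult[OF DERIV_pow[of "2 * k + 1" t "{0..x}"], of "b k / (2 * real k + 1)"] by simp
      also have "b k / (2 * real k + 1) * (real (2 * k + 1) * t ^ (2 * k)) = b k * t ^ (2 * k)"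
      proof -
        have "2 * real k + 1 \<noteq> 0" by linarith
        then show ?thesis by (simp add: add.commute)
      qed
      finally show "((\<lambda>t. b k / (2 * real k + 1) * t ^ (2 * k + 1)) has_vector_derivative b k * t ^ (2 * k)) (at t within {0..x})"
        by (simp add: has_real_derivative_iff_has_vector_derivative)
    qed (use x in auto)
    from integral_unique[OF this] show ?thesis
      by (simp only: b_def arsinh_coeff_def) (simp del: integral_mult_right integral_divide)
  qed
  moreover have "((\<lambda>t. 1 / sqrt (t\<^sup>2 + 1)) has_integral (arsinh x - arsinh 0)) {0..x}"
    using x by (intro fundamental_theorem_of_calculus)
      (auto simp flip: has_real_derivative_iff_has_vector_derivative intro!: derivative_eq_intros)
  ultimately show ?thesis by (simp add: integral_unique)
qed

text \<open>The weight \<open>v\<close> covers both integrals at once: v = 1 leads to the L-value, v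
  = cos p / sqrt (1 + cos^2 p) to the hypergeometric part. Since the cosine and \<open>v\<close> are
  at most 1 in absolute value, the coefficients themselves dominate the terms.\<close>

lemma
  assumes v: "continuous_on {0..pi/2} v" "\<And>p. p \<in> {0..pi/2} \<Longrightarrow> \<bar>v p\<bar> \<le> 1"
  shows integral_arsinh_cos_sums:
      "(\<lambda>k. (-1) ^ k * arsinh_coeff k * integral {0..pi/2} (\<lambda>p. cos p ^ (2 * k + 1) * v p))
         sums integral {0..pi/2} (\<lambda>p. arsinh (cos p) * v p)" (is ?A)
    and summable_integral_arsinh_cos:
      "summable (\<lambda>k. \<bar>arsinh_coeff k * integral {0..pi/2} (\<lambda>p. cos p ^ (2 * k + 1) * v p)\<bar>)" (is ?B)
proof -
  define f where "f k p = ((-1) ^ k * arsinh_coeff k) * (cos p ^ (2 * k + 1) * v p)" for k p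
  have f_int: "integral {0..pi/2} (f k) = (-1) ^ k * arsinh_coeff k * integral {0..pi/2} (\<lambda>p. cos p ^ (2 * k + 1) * v p)" for k
    unfolding f_def by (rule integral_mult_right)
  have cont: "continuous_on {0..pi/2} (f k)" for k
    unfolding f_def by (intro continuous_intros v)
  have le: "\<bar>f k p\<bar> \<le> arsinh_coeff k" if "p \<in> {0..pi/2}" for k p
  proof -
    have "\<bar>cos p ^ (2 * k + 1)\<bar> * \<bar>v p\<bar> \<le> 1 * 1"
    proof (rule mult_mono)
      show "\<bar>cos p ^ (2 * k + 1)\<bar> \<le> 1" unfolding power_abs by (rule power_le_one) auto
    qed (use v(2)[OF that] in auto)
    then have "arsinh_coeff k * \<bar>cos p ^ (2 * k + 1) * v p\<bar> \<le> arsinh_coeff k * 1"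
      using arsinh_coeff_nonneg[of k] by (intro mult_left_mono) (auto simp only: abs_mult mult_1)
    then show ?thesis using arsinh_coeff_nonneg[of k] by (simp add: f_def abs_mult)
  qed
  \<comment> \<open>At p = 0 the cosine is 1, outside the range of \<open>arsinh_sums\<close>; this
    one point is the exceptional set.\<close>
  have sums: "(\<lambda>k. f k p) sums (arsinh (cos p) * v p)" if "p \<in> {0..pi/2} - {0}" for p
  proof -
    have "0 \<le> cos p" "cos p < 1"
      using that cos_ge_zero[of p] cos_monotone_0_pi[of 0 p] by auto
    from sums_mult2[OF arsinh_sums[OF this], of "v p"] show ?thesis
      by (simp add: f_def mult_ac)
  qed
  note * = integral_sums[where f = f and a = 0 and b = "pi/2" and M = arsinh_coeff and N = "{0}",
      OF _ cont le summable_arsinh_coeff _ sums]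
  show ?A using *(1) by (simp add: f_int)
  show ?B using *(2) by (simp add: f_int abs_mult)
qed

text \<open>Euler's Beta integral under the substitution y = cos^m p. Two exponents are used: m = 2,
  where 1 - y = sin^2 p, and m = 4, where 1 - y = sin^2 p (1 + cos^2 p) produces the square root of
  the weight.\<close>

lemma has_integral_cos_power_Beta:
  assumes "m > 0" "a > 0"
  shows "((\<lambda>p. (real m * cos p ^ (m - 1) * sin p) * ((cos p ^ m) powr (a - 1) * (1 - cos p ^ m) powr (- 1 / 2)))
           has_integral Beta a (1 / 2)) {0<..<pi/2}"
proof -
  let ?S = "{0<..<pi/2}"
  let ?f = "\<lambda>y::real. y powr (a - 1) * (1 - y) powr (- 1 / 2)"
  let ?g = "\<lambda>p::real. cos p ^ m"
  let ?g' = "\<lambda>p::real. - (real m * cos p ^ (m - 1) * sin p)"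
  have c: "0 < cos p" "cos p < 1" "0 < sin p" if "p \<in> ?S" for p
    using that cos_gt_zero[of p] cos_monotone_0_pi[of 0 p] sin_gt_zero2[of p] by auto
  have img: "?g ` ?S = {0<..<1}"
  proof safe
    fix p :: real assume "p \<in> ?S"
    then show "cos p ^ m \<in> {0<..<1}" using c[of p] assms by (auto simp: power_less_one_iff)
  next
    fix y :: real assume y: "y \<in> {0<..<1}"
    define z where "z = root m y"
    have z: "0 < z" "z < 1" "z ^ m = y" using y assms by (auto simp: z_def)
    have "arccos z < arccos 0" "arccos 1 < arccos z" using z by (intro arccos_less_arccos; simp)+
    then have "arccos z \<in> ?S" by simp
    moreover have "y = ?g (arccos z)" using z by simp
    ultimately show "y \<in> ?g ` ?S" by blast
  qed
  have inj: "inj_on ?g ?S"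
  proof (rule inj_onI)
    fix p r assume pr: "p \<in> ?S" "r \<in> ?S" "cos p ^ m = cos r ^ m"
    then have eq: "cos p = cos r" using c[of p] c[of r] assms by (intro power_eq_imp_eq_base[of "cos p" m "cos r"]) auto
    have "0 \<le> p" "p \<le> pi" "0 \<le> r" "r \<le> pi"
      using pr(1,2) pi_gt_zero unfolding greaterThanLessThan_iff by linarith+
    then show "p = r" using eq by (rule cos_inj_pi)
  qed
  have "(?f has_integral Beta a (1 / 2)) {0<..<1}"
    using has_integral_Beta_real[of a "1/2"] assms by (simp add: has_integral_Icc_iff_Ioo)
  then have f: "(?f has_integral Beta a (1 / 2)) (?g ` ?S)" unfolding img .
  then have f': "?f absolutely_integrable_on (?g ` ?S)"
    by (intro nonnegative_absolutely_integrable_1) (auto simp: has_integral_integrable)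
  have "(\<lambda>p. \<bar>?g' p\<bar> * ?f (?g p)) absolutely_integrable_on ?S \<and>
      integral ?S (\<lambda>p. \<bar>?g' p\<bar> * ?f (?g p)) = Beta a (1 / 2)
    \<longleftrightarrow> ?f absolutely_integrable_on (?g ` ?S) \<and> integral (?g ` ?S) ?f = Beta a (1 / 2)"
  proof (rule has_absolute_integral_change_of_variables_1'[OF _ _ inj])
    show "(?g has_field_derivative ?g' p) (at p within ?S)" for p
      by (auto intro!: derivative_eq_intros)
  qed simp
  then have int: "(\<lambda>p. \<bar>?g' p\<bar> * ?f (?g p)) absolutely_integrable_on ?S"
    and val: "integral ?S (\<lambda>p. \<bar>?g' p\<bar> * ?f (?g p)) = Beta a (1 / 2)"
    using f' integral_unique[OF f] by blast+
  have "((\<lambda>p. \<bar>?g' p\<bar> * ?f (?g p)) has_integral Beta a (1 / 2)) ?S"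
    using integrable_integral[OF set_lebesgue_integral_eq_integral(1)[OF int]] unfolding val .
  then show ?thesis
  proof (rule has_integral_eq[rotated])
    fix p assume "p \<in> ?S"
    then have "0 \<le> real m * cos p ^ (m - 1) * sin p"
      using c[of p] by (intro mult_nonneg_nonneg zero_le_power) auto
    then show "\<bar>?g' p\<bar> * ?f (?g p) = (real m * cos p ^ (m - 1) * sin p) * ((cos p ^ m) powr (a - 1) * (1 - cos p ^ m) powr (- 1 / 2))"
      by (simp only: abs_minus_cancel abs_of_nonneg)
  qed
qed

lemma integral_cos_odd_power:
  "integral {0..pi/2} (\<lambda>p. cos p ^ (2 * k + 1)) = Beta (real k + 1) (1/2) / 2"
proof -
  have "((\<lambda>p. (real 2 * cos p ^ (2 - 1) * sin p) * ((cos p ^ 2) powr (real k + 1 - 1) * (1 - cos p ^ 2) powr (- 1 / 2)))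
           has_integral Beta (real k + 1) (1 / 2)) {0<..<pi/2}"
    by (rule has_integral_cos_power_Beta) auto
  then have "((\<lambda>p. 2 * cos p ^ (2 * k + 1)) has_integral Beta (real k + 1) (1 / 2)) {0<..<pi/2}"
  proof (rule has_integral_eq[rotated])
    fix p :: real assume "p \<in> {0<..<pi/2}"
    then have c: "0 < cos p" "0 < sin p" using cos_gt_zero[of p] sin_gt_zero2[of p] by auto
    have "(1 - (cos p)\<^sup>2) powr (- 1 / 2) = 1 / sin p"
      using c by (simp add: powr_minus_divide powr_half_sqrt flip: sin_squared_eq)
    moreover have "((cos p)\<^sup>2) powr (real k + 1 - 1) = cos p ^ (2 * k)"
      using c by (simp add: powr_realpow power_mult)
    ultimately show "(real 2 * cos p ^ (2 - 1) * sin p) * ((cos p ^ 2) powr (real k + 1 - 1) * (1 - cos p ^ 2) powr (- 1 / 2))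
        = 2 * cos p ^ (2 * k + 1)"
      using c by simp
  qed
  then have "((\<lambda>p. 1/2 * (2 * cos p ^ (2 * k + 1))) has_integral 1/2 * Beta (real k + 1) (1 / 2)) {0..pi/2}"
    unfolding has_integral_Icc_iff_Ioo by (rule has_integral_mult_right)
  then show ?thesis by (simp add: integral_unique)
qed

lemma integral_cos_power_div_sqrt:
  "integral {0..pi/2} (\<lambda>p. cos p ^ (2 * k + 1) * (cos p / sqrt (1 + (cos p)\<^sup>2))) = Beta (real k / 2 + 3/4) (1/2) / 4"
proof -
  \<comment> \<open>Solves 4 (a - 1) + 3 = 2 k + 2, the exponent of the cosine once y^(a - 1) meets
    the factor cos^3 p of the derivative.\<close>
  let ?a = "real k / 2 + 3/4"
  have "((\<lambda>p. (real 4 * cos p ^ (4 - 1) * sin p) * ((cos p ^ 4) powr (?a - 1) * (1 - cos p ^ 4) powr (- 1 / 2)))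
           has_integral Beta ?a (1 / 2)) {0<..<pi/2}"
    by (rule has_integral_cos_power_Beta) auto
  then have "((\<lambda>p. 4 * (cos p ^ (2 * k + 1) * (cos p / sqrt (1 + (cos p)\<^sup>2)))) has_integral Beta ?a (1 / 2)) {0<..<pi/2}"
  proof (rule has_integral_eq[rotated])
    fix p :: real assume "p \<in> {0<..<pi/2}"
    then have c: "0 < cos p" "0 < sin p" using cos_gt_zero[of p] sin_gt_zero2[of p] by auto
    have "1 - cos p ^ 4 = (sin p)\<^sup>2 * (1 + (cos p)\<^sup>2)"
      using sin_cos_squared_add[of p] by algebra
    then have 1: "(1 - cos p ^ 4) powr (- 1 / 2) = 1 / (sin p * sqrt (1 + (cos p)\<^sup>2))"
      using c by (simp add: powr_minus_divide powr_half_sqrt real_sqrt_mult)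
    have "(cos p ^ 4) powr (?a - 1) * cos p ^ 3 = cos p powr (4 * (?a - 1)) * cos p powr 3"
      using c powr_powr[of "cos p" 4 "?a - 1"] by simp
    also have "\<dots> = cos p powr real (2 * k + 2)"
      by (simp add: algebra_simps flip: powr_add)
    also have "\<dots> = cos p ^ (2 * k + 2)" using c by (intro powr_realpow)
    finally have 2: "(cos p ^ 4) powr (?a - 1) * cos p ^ 3 = cos p ^ (2 * k + 2)" .
    have "(real 4 * cos p ^ (4 - 1) * sin p) * ((cos p ^ 4) powr (?a - 1) * (1 - cos p ^ 4) powr (- 1 / 2))
        = 4 * ((cos p ^ 4) powr (?a - 1) * cos p ^ 3) * (sin p * (1 - cos p ^ 4) powr (- 1 / 2))"
      by simp
    also have "\<dots> = 4 * cos p ^ (2 * k + 2) * (sin p * (1 / (sin p * sqrt (1 + (cos p)\<^sup>2))))"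
      by (simp only: 1 2)
    also have "\<dots> = 4 * (cos p ^ (2 * k + 1) * (cos p / sqrt (1 + (cos p)\<^sup>2)))"
      using c by (simp add: field_simps)
    finally show "(real 4 * cos p ^ (4 - 1) * sin p) * ((cos p ^ 4) powr (?a - 1) * (1 - cos p ^ 4) powr (- 1 / 2))
        = 4 * (cos p ^ (2 * k + 1) * (cos p / sqrt (1 + (cos p)\<^sup>2)))" .
  qed
  then have "((\<lambda>p. 1/4 * (4 * (cos p ^ (2 * k + 1) * (cos p / sqrt (1 + (cos p)\<^sup>2))))) has_integral 1/4 * Beta ?a (1 / 2)) {0..pi/2}"
    unfolding has_integral_Icc_iff_Ioo by (rule has_integral_mult_right)
  then show ?thesis by (simp add: integral_unique)
qed

section \<open>Gamma values and the splitting of alternating series\<close>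

lemma Gamma_plus1_real_pos: "x > 0 \<Longrightarrow> Gamma (x + 1) = x * Gamma (x :: real)"
  by (rule Gamma_plus1) (auto elim!: nonpos_Ints_cases)

lemma Gamma_shift_values:
  "Gamma (3/2 :: real) = sqrt pi / 2" "Gamma (5/4 :: real) = Gamma (1/4) / 4"
  "Gamma (7/4 :: real) = 3/4 * Gamma (3/4)"
  using Gamma_plus1_real_pos[of "1/2"] Gamma_plus1_real_pos[of "1/4"] Gamma_plus1_real_pos[of "3/4"]
  by (auto simp: Gamma_one_half_real)

lemma summable_even_odd:
  fixes f :: "nat \<Rightarrow> real"
  assumes "summable (\<lambda>k. \<bar>f k\<bar>)"
  shows "summable (\<lambda>n. f (2 * n))" "summable (\<lambda>n. f (2 * n + 1))"
proof -
  have "inj (\<lambda>n::nat. 2 * n)" "inj (\<lambda>n::nat. 2 * n + 1)" by (auto simp: inj_on_def)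
  from this[THEN summable_reindex[OF assms]]
  show "summable (\<lambda>n. f (2 * n))" "summable (\<lambda>n. f (2 * n + 1))"
    by (auto simp: o_def intro: summable_rabs_cancel)
qed

lemma suminf_alternating:
  fixes f :: "nat \<Rightarrow> real"
  assumes "summable (\<lambda>k. \<bar>f k\<bar>)"
  shows "(\<Sum>k. (-1) ^ k * f k) = (\<Sum>n. f (2 * n)) - (\<Sum>n. f (2 * n + 1))"
proof -
  have s: "summable (\<lambda>k. (-1) ^ k * f k)"
    by (rule summable_rabs_cancel) (use assms in \<open>simp add: abs_mult\<close>)
  have ev: "summable (\<lambda>n. f (2 * n))" and od: "summable (\<lambda>n. f (2 * n + 1))"
    by (rule summable_even_odd[OF assms])+
  have "(\<lambda>n. sum (\<lambda>k. (-1) ^ k * f k) {n * 2..<n * 2 + 2}) sums (\<Sum>k. (-1) ^ k * f k)"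
    by (rule sums_group[OF summable_sums[OF s]]) simp
  moreover have "sum (\<lambda>k. (-1) ^ k * f k) {n * 2..<n * 2 + 2} = f (2 * n) - f (2 * n + 1)" for n
  proof -
    have "{n * 2..<n * 2 + 2} = {2 * n, 2 * n + 1}" by auto
    then show ?thesis by simp
  qed
  ultimately have "(\<lambda>n. f (2 * n) - f (2 * n + 1)) sums (\<Sum>k. (-1) ^ k * f k)" by simp
  moreover have "(\<lambda>n. f (2 * n) - f (2 * n + 1)) sums ((\<Sum>n. f (2 * n)) - (\<Sum>n. f (2 * n + 1)))"
    by (intro sums_diff summable_sums ev od)
  ultimately show ?thesis by (rule sums_unique2)
qed

section \<open>Catalan's constant as a cosine integral\<close>

lemma L_chi_m4_2: "L_chi_m4 2 = integral {0..pi/2} (\<lambda>p. arsinh (cos p))"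
proof -
  have "(\<lambda>k. (-1) ^ k * arsinh_coeff k * integral {0..pi/2} (\<lambda>p. cos p ^ (2 * k + 1) * 1))
         sums integral {0..pi/2} (\<lambda>p. arsinh (cos p) * 1)"
    by (rule integral_arsinh_cos_sums) auto
  then have "(\<lambda>k. (-1) ^ k * (arsinh_coeff k * (Beta (real k + 1) (1/2) / 2))) sums integral {0..pi/2} (\<lambda>p. arsinh (cos p))"
    by (simp only: mult_1_right integral_cos_odd_power mult.assoc)
  moreover have "arsinh_coeff k * (Beta (real k + 1) (1/2) / 2) = 1 / (2 * real k + 1)\<^sup>2" for k
  proof -
    \<comment> \<open>Up to the factor 2 / (2k + 1) this is the reciprocal of (1/2)_k / k!, so the
      product with \<open>arsinh_coeff k\<close> leaves only 1 / (2k + 1)^2.\<close>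
    have "Beta (real k + 1) (1/2) = 2 * fact k / ((2 * real k + 1) * pochhammer (1/2) k)"
    proof (induction k)
      case 0
      have "Beta 1 (1/2 :: real) = 2"
        by (simp add: Beta_def Gamma_shift_values Gamma_one_half_real)
      then show ?case by simp
    next
      case (Suc k)
      have "(real k + 1 + 1/2) * Beta (real k + 1 + 1) (1/2) = (real k + 1) * Beta (real k + 1) (1/2)"
        by (rule Beta_plus1_left) (auto elim!: nonpos_Ints_cases)
      then have "Beta (real k + 1 + 1) (1/2) = (real k + 1) / (real k + 3/2) * Beta (real k + 1) (1/2)"
        by (simp add: field_simps)
      also have "\<dots> = 2 * fact (Suc k) / ((2 * real (Suc k) + 1) * pochhammer (1/2) (Suc k))"
        unfolding Suc.IH using pochhammer_pos[of "1/2 :: real" k]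
        by (simp add: pochhammer_Suc divide_simps) (simp add: algebra_simps)
      finally show ?case by (simp add: add.commute)
    qed
    moreover have "pochhammer (1/2 :: real) k > 0" by (rule pochhammer_pos) simp
    ultimately show ?thesis by (simp add: arsinh_coeff_def power2_eq_square)
  qed
  ultimately have sums: "(\<lambda>k. (-1) ^ k / (2 * real k + 1)\<^sup>2) sums integral {0..pi/2} (\<lambda>p. arsinh (cos p))"
    by simp
  have "(\<lambda>k. chi_m4 (Suc (2 * k)) / real (Suc (2 * k)) powr 2) sums integral {0..pi/2} (\<lambda>p. arsinh (cos p))"
  proof -
    have "chi_m4 (Suc (2 * k)) = (-1) ^ k" for k
    proof (cases "even k")
      case True
      then obtain j where "k = 2 * j" by blast
      then have "Suc (2 * k) = 4 * j + 1" by simp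
      then have "Suc (2 * k) mod 4 = 1" by presburger
      then show ?thesis using True by (simp add: chi_m4_def)
    next
      case False
      then obtain j where "k = 2 * j + 1" by (auto elim: oddE)
      then have "Suc (2 * k) = 4 * j + 3" by simp
      then have "Suc (2 * k) mod 4 = 3" by presburger
      then show ?thesis using False by (simp add: chi_m4_def)
    qed
    then show ?thesis using sums by (simp add: add.commute)
  qed
  moreover have "strict_mono (\<lambda>k::nat. 2 * k)" by (auto simp: strict_mono_def)
  \<comment> \<open>Index n stands for the integer n + 1, so the odd n are the even integers, where
    the character vanishes.\<close>
  moreover have "chi_m4 (Suc n) / real (Suc n) powr 2 = 0" if "n \<notin> range (\<lambda>k. 2 * k)" for n
  proof -
    have "odd n" using that by (auto elim!: evenE)
    then have "Suc n mod 4 \<noteq> 1" "Suc n mod 4 \<noteq> 3" by presburger+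
    then show ?thesis by (simp add: chi_m4_def)
  qed
  ultimately have "(\<lambda>n. chi_m4 (Suc n) / real (Suc n) powr 2) sums integral {0..pi/2} (\<lambda>p. arsinh (cos p))"
    using sums_mono_reindex[of "\<lambda>k. 2 * k" "\<lambda>n. chi_m4 (Suc n) / real (Suc n) powr 2"] by simp
  then show ?thesis by (simp add: L_chi_m4_def sums_iff)
qed

section \<open>Even and odd terms as hypergeometric series\<close>

definition C_term :: "nat \<Rightarrow> real" where
  "C_term k = arsinh_coeff k * (Beta (real k / 2 + 3/4) (1/2) / 4)"

text \<open>Two steps in k raise the Beta argument k/2 + 3/4 by exactly 1, so the functional
  equation of Beta applies; a single step raises it by 1/2 only. Hence the terms of each parity form
  a hypergeometric series of their own.\<close>

lemma C_term_rec:
  "C_term (k + 2) = C_term k * ((real k + 1/2)\<^sup>2 * (real k + 3/2)\<^sup>2 / ((real k + 1) * (real k + 2) * (real k + 5/2)\<^sup>2))"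
proof -
  have "(real k / 2 + 3/4 + 1/2) * Beta (real k / 2 + 3/4 + 1) (1/2) = (real k / 2 + 3/4) * Beta (real k / 2 + 3/4) (1/2)"
    by (rule Beta_plus1_left) (auto elim!: nonpos_Ints_cases)
  moreover have *: "real (k + 2) / 2 + 3/4 = real k / 2 + 3/4 + 1" by (simp add: field_simps)
  ultimately have B: "Beta (real (k + 2) / 2 + 3/4) (1/2) = (real k + 3/2) / (real k + 5/2) * Beta (real k / 2 + 3/4) (1/2)"
    unfolding * by (simp add: field_simps)
  have A: "arsinh_coeff (k + 2) = arsinh_coeff k * ((real k + 1/2)\<^sup>2 * (real k + 3/2) / ((real k + 1) * (real k + 2) * (real k + 5/2)))"
    by (simp add: arsinh_coeff_def pochhammer_Suc divide_simps power2_eq_square) (simp add: algebra_simps)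
  have "co * (u\<^sup>2 * v / (c * d * e)) * (v / e * X / 4) = co * (X / 4) * (u\<^sup>2 * v\<^sup>2 / (c * d * e\<^sup>2))"
    for co u v c d e X :: real
    by (simp add: power2_eq_square mult_ac)
  then show ?thesis unfolding C_term_def A B .
qed

text \<open>Euler's reflection formula at 1/4. It turns the quotients of Gamma (3/4) and Gamma (1/4)
  in the leading terms into the squares that occur in \<open>C_sqrt2\<close>.\<close>

lemma Gamma_quarter_times: "Gamma (1/4) * Gamma (3/4) = pi * sqrt (2 :: real)"
proof -
  have "complex_of_real (Gamma (1/4) * Gamma (3/4)) = of_real pi / sin (of_real pi * (1/4))"
    using Gamma_reflection_complex[of "1/4"] Gamma_complex_of_real[of "1/4"] Gamma_complex_of_real[of "3/4"] by simp
  also have "sin (of_real pi * (1/4)) = complex_of_real (sin (pi / 4))"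
    by (simp flip: sin_of_real)
  also have "of_real pi / complex_of_real (sin (pi / 4)) = complex_of_real (pi * sqrt 2)"
  proof -
    have "pi / sin (pi / 4) = pi * sqrt 2" by (simp add: sin_45 field_simps)
    then show ?thesis by (simp only: flip: of_real_divide)
  qed
  finally show ?thesis by (simp only: of_real_eq_iff)
qed

lemma sqrt_two_pi_cubed: "sqrt (2 * pi ^ 3) = sqrt 2 * sqrt pi * pi"
  by (simp add: real_sqrt_mult power3_eq_cube)

lemma C_term_0: "C_term 0 = pi * (Gamma (3/4) ^ 2 / sqrt (2 * pi ^ 3))"
proof -
  have "C_term 0 = Gamma (3/4) * sqrt pi / Gamma (1/4)"
    by (simp add: C_term_def arsinh_coeff_def Beta_def Gamma_shift_values Gamma_one_half_real)
  also have "\<dots> = Gamma (3/4) ^ 2 * pi / (sqrt pi * (Gamma (1/4) * Gamma (3/4)))"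
    using less_imp_neq[OF Gamma_real_pos[of "1/4"]] less_imp_neq[OF Gamma_real_pos[of "3/4"]]
    by (simp add: divide_simps power2_eq_square)
  also have "\<dots> = pi * (Gamma (3/4) ^ 2 / sqrt (2 * pi ^ 3))"
    unfolding Gamma_quarter_times sqrt_two_pi_cubed by (simp add: field_simps)
  finally show ?thesis .
qed

lemma C_term_1: "C_term 1 = pi * (Gamma (1/4) ^ 2 / (72 * sqrt (2 * pi ^ 3)))"
proof -
  \<comment> \<open>72 = 6 * 12: the coefficient is 1/6, and Beta (5/4) (1/2) / 4 = Gamma (1/4) *
    sqrt pi / (12 * Gamma (3/4)).\<close>
  have "C_term 1 = Gamma (1/4) * sqrt pi / (72 * Gamma (3/4))"
    by (simp add: C_term_def arsinh_coeff_def Beta_def Gamma_shift_values Gamma_one_half_real)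
  also have "\<dots> = Gamma (1/4) ^ 2 * pi / (72 * sqrt pi * (Gamma (1/4) * Gamma (3/4)))"
    using less_imp_neq[OF Gamma_real_pos[of "1/4"]] less_imp_neq[OF Gamma_real_pos[of "3/4"]]
    by (simp add: divide_simps power2_eq_square)
  also have "\<dots> = pi * (Gamma (1/4) ^ 2 / (72 * sqrt (2 * pi ^ 3)))"
    unfolding Gamma_quarter_times sqrt_two_pi_cubed by (simp add: field_simps)
  finally show ?thesis .
qed

text \<open>The recurrence at k = 2 n or k = 2 n + 1 has four doubled factors above and four below;
  the powers of 2 cancel, which is why both series are evaluated at 1. The factor \<open>d\<close>
  comes last because it becomes the n + 1 of the factorial.\<close>

lemma four_factor_ratio:
  "(2 * a)\<^sup>2 * (2 * b)\<^sup>2 / (2 * c * (2 * d) * (2 * e)\<^sup>2) = a\<^sup>2 * b\<^sup>2 / (c * e\<^sup>2 * d)" for a b c d e :: real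
proof -
  have "(2 * a)\<^sup>2 * (2 * b)\<^sup>2 / (2 * c * (2 * d) * (2 * e)\<^sup>2) = (16 * (a\<^sup>2 * b\<^sup>2)) / (16 * (c * e\<^sup>2 * d))"
    by (simp add: power_mult_distrib mult_ac)
  then show ?thesis unfolding mult_divide_mult_cancel_left_if by simp
qed

lemma C_term_even:
  "C_term (2 * n) = C_term 0 * ((\<Prod>a\<leftarrow>[1/4, 1/4, 3/4, 3/4]. pochhammer a n) / (\<Prod>b\<leftarrow>[1/2, 5/4, 5/4]. pochhammer b n) * 1 ^ n / fact n)"
proof (induction n)
  case (Suc n)
  have p: "pochhammer (1/2 :: real) n > 0" "pochhammer (5/4 :: real) n > 0" by (auto intro: pochhammer_pos)
  have "C_term (2 * Suc n) = C_term (2 * n) * ((2 * real n + 1/2)\<^sup>2 * (2 * real n + 3/2)\<^sup>2 / ((2 * real n + 1) * (2 * real n + 2) * (2 * real n + 5/2)\<^sup>2))"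
    using C_term_rec[of "2 * n"] by simp
  also have "(2 * real n + 1/2)\<^sup>2 * (2 * real n + 3/2)\<^sup>2 / ((2 * real n + 1) * (2 * real n + 2) * (2 * real n + 5/2)\<^sup>2)
     = (1/4 + real n)\<^sup>2 * (3/4 + real n)\<^sup>2 / ((1/2 + real n) * (5/4 + real n)\<^sup>2 * (1 + real n))"
  proof -
    have "2 * real n + 1/2 = 2 * (1/4 + real n)" "2 * real n + 3/2 = 2 * (3/4 + real n)"
      "2 * real n + 1 = 2 * (1/2 + real n)" "2 * real n + 2 = 2 * (1 + real n)" "2 * real n + 5/2 = 2 * (5/4 + real n)"
      by simp_all
    then show ?thesis by (simp only: four_factor_ratio)
  qed
  finally show ?case using p
    unfolding Suc.IH by (simp add: pochhammer_Suc power2_eq_square mult_ac)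
qed simp

lemma C_term_odd:
  "C_term (2 * n + 1) = C_term 1 * ((\<Prod>a\<leftarrow>[3/4, 3/4, 5/4, 5/4]. pochhammer a n) / (\<Prod>b\<leftarrow>[3/2, 7/4, 7/4]. pochhammer b n) * 1 ^ n / fact n)"
proof (induction n)
  case (Suc n)
  have p: "pochhammer (3/2 :: real) n > 0" "pochhammer (7/4 :: real) n > 0" by (auto intro: pochhammer_pos)
  have "C_term (2 * Suc n + 1) = C_term (2 * n + 1) * ((2 * real n + 3/2)\<^sup>2 * (2 * real n + 5/2)\<^sup>2 / ((2 * real n + 3) * (2 * real n + 2) * (2 * real n + 7/2)\<^sup>2))"
    using C_term_rec[of "2 * n + 1"] by (simp add: algebra_simps)
  also have "(2 * real n + 3/2)\<^sup>2 * (2 * real n + 5/2)\<^sup>2 / ((2 * real n + 3) * (2 * real n + 2) * (2 * real n + 7/2)\<^sup>2)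
     = (3/4 + real n)\<^sup>2 * (5/4 + real n)\<^sup>2 / ((3/2 + real n) * (7/4 + real n)\<^sup>2 * (1 + real n))"
  proof -
    have "2 * real n + 3/2 = 2 * (3/4 + real n)" "2 * real n + 5/2 = 2 * (5/4 + real n)"
      "2 * real n + 3 = 2 * (3/2 + real n)" "2 * real n + 2 = 2 * (1 + real n)" "2 * real n + 7/2 = 2 * (7/4 + real n)"
      by simp_all
    then show ?thesis by (simp only: four_factor_ratio)
  qed
  finally show ?case using p
    unfolding Suc.IH by (simp add: pochhammer_Suc power2_eq_square mult_ac)
qed simp

lemma C_sqrt2_eq: "pi * C_sqrt2 = integral {0..pi/2} (\<lambda>p. arsinh (cos p) * cos p / sqrt (1 + (cos p)\<^sup>2))"
proof -
  let ?v = "\<lambda>p::real. cos p / sqrt (1 + (cos p)\<^sup>2)"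
  have v: "continuous_on {0..pi/2} ?v" "\<bar>?v p\<bar> \<le> 1" for p
  proof -
    have pos: "0 < 1 + (cos x)\<^sup>2" for x :: real by (simp add: add_pos_nonneg)
    then show "continuous_on {0..pi/2} ?v" by (intro continuous_intros) (auto simp: less_imp_neq[symmetric])
    have "\<bar>cos p\<bar> \<le> sqrt (1 + (cos p)\<^sup>2)" by (rule real_le_rsqrt) simp
    then show "\<bar>?v p\<bar> \<le> 1" using pos[of p] by simp
  qed
  have C: "C_term k = arsinh_coeff k * integral {0..pi/2} (\<lambda>p. cos p ^ (2 * k + 1) * ?v p)" for k
    unfolding C_term_def integral_cos_power_div_sqrt ..
  have sums: "(\<lambda>k. (-1) ^ k * C_term k) sums integral {0..pi/2} (\<lambda>p. arsinh (cos p) * ?v p)"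
    using integral_arsinh_cos_sums[of ?v] v by (simp only: C mult.assoc)
  have summ: "summable (\<lambda>k. \<bar>C_term k\<bar>)"
    unfolding C by (rule summable_integral_arsinh_cos) (use v in auto)
  have ev: "summable (\<lambda>n. C_term (2 * n))" and od: "summable (\<lambda>n. C_term (2 * n + 1))"
    by (rule summable_even_odd[OF summ])+
  \<comment> \<open>The leading terms must be nonzero to be divided out: this transfers summability
    from the \<open>C_term\<close> series to the hypergeometric series.\<close>
  have nz: "C_term 0 \<noteq> 0" "C_term 1 \<noteq> 0" unfolding C_term_0 C_term_1
    using less_imp_neq[OF Gamma_real_pos[of "1/4"]] less_imp_neq[OF Gamma_real_pos[of "3/4"]] by auto
  have "(\<Sum>n. C_term (2 * n)) = C_term 0 * hypergeom [1/4, 1/4, 3/4, 3/4] [1/2, 5/4, 5/4] 1"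
    unfolding C_term_even hypergeom_def
    by (rule suminf_mult[OF summable_mult_D[OF ev[unfolded C_term_even] nz(1)]])
  moreover have "(\<Sum>n. C_term (2 * n + 1)) = C_term 1 * hypergeom [3/4, 3/4, 5/4, 5/4] [3/2, 7/4, 7/4] 1"
    unfolding C_term_odd hypergeom_def
    by (rule suminf_mult[OF summable_mult_D[OF od[unfolded C_term_odd] nz(2)]])
  moreover have "integral {0..pi/2} (\<lambda>p. arsinh (cos p) * ?v p) = (\<Sum>n. C_term (2 * n)) - (\<Sum>n. C_term (2 * n + 1))"
    using sums suminf_alternating[OF summ] by (simp add: sums_iff)
  ultimately show ?thesis by (simp add: C_sqrt2_def C_term_0 C_term_1[simplified] right_diff_distrib mult.assoc)
qed

section \<open>Elementary integrals\<close>

lemma one_plus_square [simp]: "0 < 1 + x\<^sup>2" "1 + x\<^sup>2 \<noteq> 0" for x :: real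
  by (metis add_pos_nonneg zero_le_power2 zero_less_one less_irrefl)+

text \<open>The contribution of one ray: the integral of r * disc_log r from exp (-h) to exp h, as
  \<open>integral_disc_log\<close> confirms.\<close>

definition sector_integral :: "real \<Rightarrow> real" where
  "sector_integral h = 1 / 8 - exp (- 4 * h) / 8 + h * exp (2 * h) / 2 - (exp (2 * h) - exp (- 2 * h)) / 4"

lemma cos_sqrt_sq [simp]: "(sqrt (1 + (cos p)\<^sup>2))\<^sup>2 = 1 + (cos p)\<^sup>2" "sqrt (1 + (cos p)\<^sup>2) > 0"
  "sqrt (1 + (cos p)\<^sup>2) \<noteq> 0" for p :: real
  by (auto simp: one_plus_square less_imp_le)

lemma sqrt_cos_has_derivative:
  "((\<lambda>p. sqrt (1 + (cos p)\<^sup>2)) has_real_derivative - (cos p * sin p / sqrt (1 + (cos p)\<^sup>2))) (at p within A)"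
proof -
  have "((\<lambda>p. 1 + (cos p)\<^sup>2) has_real_derivative - (2 * cos p * sin p)) (at p within A)"
    by (auto intro!: derivative_eq_intros)
  from DERIV_chain2[OF DERIV_real_sqrt this] show ?thesis
    by (simp add: field_simps)
qed

lemma arsinh_cos_has_derivative:
  "((\<lambda>p. arsinh (cos p)) has_real_derivative - (sin p / sqrt (1 + (cos p)\<^sup>2))) (at p within A)"
proof -
  have "((\<lambda>p. arsinh (cos p)) has_real_derivative 1 / sqrt ((cos p)\<^sup>2 + 1) * - sin p) (at p within A)"
    by (rule DERIV_chain2[OF arsinh_real_has_field_derivative]) (auto intro!: derivative_eq_intros)
  then show ?thesis by (simp add: add.commute)
qed

text \<open>From sinh h = C and cosh h = q follow exp h = C + q and exp (-h) = q - C, so every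
  exponential becomes a polynomial in C and q.\<close>

lemma sector_integral_arsinh_cos:
  fixes p :: real
  defines "C \<equiv> cos p" and "q \<equiv> sqrt (1 + (cos p)\<^sup>2)" and "h \<equiv> arsinh (cos p)"
  shows "2 * (C / q * sector_integral h)
       = h * C / q + 2 * h * C ^ 3 / q + 2 * h * C\<^sup>2 - 2 * C ^ 3 * q - C\<^sup>2 + 2 * C ^ 4"
proof -
  have q: "q > 0" "q\<^sup>2 = 1 + C\<^sup>2" by (auto simp: q_def C_def)
  have "sinh h = C" "cosh h = q"
    by (auto simp: h_def C_def q_def cosh_arsinh_real add.commute)
  then have e: "exp h = C + q" "exp (- h) = q - C"
    by (auto simp: sinh_def cosh_def field_simps)
  have e2: "exp (2 * h) = (C + q)\<^sup>2" "exp (- 2 * h) = (q - C)\<^sup>2" "exp (- 4 * h) = (q - C) ^ 4"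
    using exp_of_nat_mult[of 2 h] exp_of_nat_mult[of 2 "- h"] exp_of_nat_mult[of 4 "- h"] e by auto
  \<comment> \<open>With the reciprocal of q as a variable bound by i * q = 1, the claim is a
    polynomial identity.\<close>
  define i where "i = 1 / q"
  have i: "i * q = 1" using q by (simp add: i_def)
  have "2 * (C * i * (1 / 8 - (q - C) ^ 4 / 8 + h * (C + q)\<^sup>2 / 2 - ((C + q)\<^sup>2 - (q - C)\<^sup>2) / 4))
      = h * C * i + 2 * h * C ^ 3 * i + 2 * h * C\<^sup>2 - 2 * C ^ 3 * q - C\<^sup>2 + 2 * C ^ 4"
    using q(2) i by algebra
  then show ?thesis unfolding sector_integral_def e2 by (simp add: i_def)
qed

lemma integral_sector_integral:
  "2 * integral {0..1} (\<lambda>t. sector_integral (arsinh (sqrt ((1 - t\<^sup>2) / (1 + t\<^sup>2)))) / (1 + t\<^sup>2))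
   = integral {0..pi/2} (\<lambda>p. arsinh (cos p) * cos p / sqrt (1 + (cos p)\<^sup>2))
     + integral {0..pi/2} (\<lambda>p. arsinh (cos p)) + 3 * pi / 8 - 3 / 2"
proof -
  let ?f = "\<lambda>t. sector_integral (arsinh (sqrt ((1 - t\<^sup>2) / (1 + t\<^sup>2)))) / (1 + t\<^sup>2)"
  let ?q = "\<lambda>p. sqrt (1 + (cos p)\<^sup>2)"
  let ?h = "\<lambda>p. arsinh (cos p)"
  \<comment> \<open>The slope t = tan u when sin p = sqrt 2 * sin u, since then cos u = sqrt ((1 +
    cos^2 p) / 2).\<close>
  define g where "g p = sin p / ?q p" for p :: real
  have g_sq: "1 + (g p)\<^sup>2 = 2 / (?q p)\<^sup>2" "1 - (g p)\<^sup>2 = 2 * (cos p)\<^sup>2 / (?q p)\<^sup>2" for p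
  proof -
    have s: "(sin p)\<^sup>2 = 1 - (cos p)\<^sup>2" using sin_cos_squared_add2[of p] by (simp add: algebra_simps)
    have n: "1 + (cos p)\<^sup>2 \<noteq> 0" by (rule one_plus_square)
    show "1 + (g p)\<^sup>2 = 2 / (?q p)\<^sup>2" "1 - (g p)\<^sup>2 = 2 * (cos p)\<^sup>2 / (?q p)\<^sup>2"
      using n by (auto simp: g_def power_divide s divide_simps)
  qed
  have "((\<lambda>p. (2 * cos p / ?q p ^ 3) *\<^sub>R ?f (g p)) has_integral integral {g 0..g (pi/2)} ?f) {0..pi/2}"
  proof (rule has_integral_substitution)
    show "g ` {0..pi/2} \<subseteq> {0..1}"
    proof (rule image_subsetI)
      fix p :: real assume p: "p \<in> {0..pi/2}"
      then have "0 \<le> g p" by (auto simp: g_def sin_ge_zero)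
      moreover have "0 \<le> 1 - (g p)\<^sup>2" unfolding g_sq by simp
      ultimately show "g p \<in> {0..1}" by (auto simp: abs_square_le_1)
    qed
    show "continuous_on {0..1} ?f"
      unfolding sector_integral_def
      by (intro continuous_intros) (auto simp: one_plus_square)
    fix p :: real
    have "(g has_real_derivative (cos p * ?q p - sin p * (- (cos p * sin p / ?q p))) / (?q p * ?q p)) (at p within {0..pi/2})"
      unfolding g_def by (intro DERIV_divide DERIV_sin[THEN has_field_derivative_at_within] sqrt_cos_has_derivative) simp
    also have "(cos p * ?q p - sin p * (- (cos p * sin p / ?q p))) / (?q p * ?q p) = 2 * cos p / ?q p ^ 3"
    proof -
      define q where "q = ?q p"
      have q: "q \<noteq> 0" "q\<^sup>2 = 1 + (cos p)\<^sup>2" by (auto simp: q_def)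
      have s: "(sin p)\<^sup>2 = 1 - (cos p)\<^sup>2" using sin_cos_squared_add2[of p] by (simp add: algebra_simps)
      have "(cos p * q - sin p * (- (cos p * sin p / q))) / (q * q) = cos p * (q\<^sup>2 + (sin p)\<^sup>2) / q ^ 3"
        using q(1) by (simp add: field_simps power2_eq_square power3_eq_cube)
      then show ?thesis by (simp add: q s flip: q_def)
    qed
    finally show "(g has_real_derivative 2 * cos p / ?q p ^ 3) (at p within {0..pi/2})" .
  qed (auto simp: g_def)
  then have sub: "((\<lambda>p. 2 * ((2 * cos p / ?q p ^ 3) *\<^sub>R ?f (g p))) has_integral 2 * integral {0..1} ?f) {0..pi/2}"
    by (intro has_integral_mult_right) (simp add: g_def)
  \<comment> \<open>What remains once the two integrands kept for series expansion are split off.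
    The integrand h is added and subtracted because 2 h cos^2 p - h has, up to elementary terms, the
    primitive h sin p cos p.\<close>
  define w where "w p = 2 * ?h p * cos p ^ 3 / ?q p + 2 * ?h p * (cos p)\<^sup>2 - 2 * cos p ^ 3 * ?q p - (cos p)\<^sup>2 + 2 * cos p ^ 4 - ?h p" for p
  have eq: "2 * ((2 * cos p / ?q p ^ 3) *\<^sub>R ?f (g p)) = ?h p * cos p / ?q p + ?h p + w p"
    if "p \<in> {0..pi/2}" for p
  proof -
    have c: "cos p \<ge> 0" using that by (auto intro: cos_ge_zero)
    have "(1 - (g p)\<^sup>2) / (1 + (g p)\<^sup>2) = (cos p)\<^sup>2"
      unfolding g_sq by (subst (1 2) cos_sqrt_sq(1)) (simp add: divide_simps)
    then have "?f (g p) = sector_integral (arsinh (sqrt ((cos p)\<^sup>2))) / (2 / (?q p)\<^sup>2)"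
      by (simp only: g_sq(1))
    also have "\<dots> = sector_integral (?h p) * (?q p)\<^sup>2 / 2"
      using c by (simp del: cos_sqrt_sq(1))
    finally have f: "?f (g p) = sector_integral (?h p) * (?q p)\<^sup>2 / 2" .
    have aux: "2 * ((2 * c / q ^ 3) *\<^sub>R (s * q\<^sup>2 / 2)) = 2 * (c / q * s)" if "q \<noteq> 0" for c q s :: real
      using that by (simp add: power2_eq_square power3_eq_cube)
    have "2 * ((2 * cos p / ?q p ^ 3) *\<^sub>R ?f (g p)) = 2 * (cos p / ?q p * sector_integral (?h p))"
      unfolding f by (rule aux) (rule cos_sqrt_sq(3))
    then show ?thesis unfolding sector_integral_arsinh_cos w_def by simp
  qed
  \<comment> \<open>The derivative of h sin p q is 2 h cos^3 p / q - sin^2 p, and that of h sin p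
    cos p is h (2 cos^2 p - 1) - sin^2 p cos p / q; the other summands integrate the elementary
    leftovers.\<close>
  define F where "F p = ?h p * sin p * ?q p + ?h p * sin p * cos p - 3 / 2 * sin p * ?q p
     - 1 / 2 * sin p * ?q p * (cos p)\<^sup>2 + 3 / 4 * p - 1 / 4 * sin p * cos p + 1 / 2 * sin p * cos p ^ 3" for p
  have w: "(w has_integral (F (pi/2) - F 0)) {0..pi/2}"
  proof (rule fundamental_theorem_of_calculus)
    fix p :: real
    define i where "i = 1 / ?q p"
    have r: "i * ?q p = 1" "(?q p)\<^sup>2 = 1 + (cos p)\<^sup>2" "(sin p)\<^sup>2 = 1 - (cos p)\<^sup>2"
      using sin_cos_squared_add2[of p] by (auto simp: i_def algebra_simps)
    have d: "(?h has_real_derivative - (sin p * i)) (at p within {0..pi/2})"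
      "(?q has_real_derivative - (cos p * sin p * i)) (at p within {0..pi/2})"
      "(sin has_real_derivative cos p) (at p within {0..pi/2})"
      "(cos has_real_derivative - sin p) (at p within {0..pi/2})"
      "((\<lambda>p. (cos p)\<^sup>2) has_real_derivative - (2 * cos p * sin p)) (at p within {0..pi/2})"
      "((\<lambda>p. cos p ^ 3) has_real_derivative - (3 * (cos p)\<^sup>2 * sin p)) (at p within {0..pi/2})"
      using arsinh_cos_has_derivative[of p] sqrt_cos_has_derivative[of p]
      by (auto simp: i_def intro!: derivative_eq_intros)
    have "(F has_real_derivative 2 * ?h p * cos p ^ 3 * i + 2 * ?h p * (cos p)\<^sup>2 - 2 * cos p ^ 3 * ?q p
        - (cos p)\<^sup>2 + 2 * cos p ^ 4 - ?h p) (at p within {0..pi/2})"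
      unfolding F_def
    proof (rule DERIV_cong, (rule d DERIV_add DERIV_diff DERIV_mult DERIV_const DERIV_ident)+, goal_cases)
      case 1
      show ?case using r by algebra
    qed
    then show "(F has_vector_derivative w p) (at p within {0..pi/2})"
      by (simp add: has_real_derivative_iff_has_vector_derivative w_def i_def)
  qed simp
  have int1: "(\<lambda>p. ?h p * cos p / ?q p) integrable_on {0..pi/2}" and int2: "?h integrable_on {0..pi/2}"
    by (auto intro!: integrable_continuous_real continuous_intros)
  have "((\<lambda>p. ?h p * cos p / ?q p + ?h p + w p) has_integral
      integral {0..pi/2} (\<lambda>p. ?h p * cos p / ?q p) + integral {0..pi/2} ?h + (F (pi/2) - F 0)) {0..pi/2}"
    by (intro has_integral_add w integrable_integral int1 int2)
  moreover have "((\<lambda>p. ?h p * cos p / ?q p + ?h p + w p) has_integral 2 * integral {0..1} ?f) {0..pi/2}"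
    by (rule has_integral_eq[OF eq sub])
  ultimately have "2 * integral {0..1} ?f
     = integral {0..pi/2} (\<lambda>p. ?h p * cos p / ?q p) + integral {0..pi/2} ?h + (F (pi/2) - F 0)"
    by (rule has_integral_unique[rotated])
  \<comment> \<open>The source of the elementary constants: division by pi turns them into 3/8 and
    -3 / (2 pi).\<close>
  moreover have "F (pi/2) - F 0 = 3 * pi / 8 - 3 / 2" by (simp add: F_def)
  ultimately show ?thesis by simp
qed

section \<open>Lebesgue measure on the complex plane\<close>

lemma measurable_Complex [measurable]:
  assumes [measurable]: "f \<in> borel_measurable M" "g \<in> borel_measurable M"
  shows "(\<lambda>x. Complex (f x) (g x)) \<in> borel_measurable M"
  by (subst borel_measurable_complex_iff) (simp add: assms)

lemma lborel_complex_eq: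
  "(lborel :: complex measure) = distr (lborel \<Otimes>\<^sub>M lborel) borel (\<lambda>(x, y). Complex x y)"
proof (rule lborel_eqI)
  fix l u :: complex
  assume le: "\<And>b. b \<in> Basis \<Longrightarrow> l \<bullet> b \<le> u \<bullet> b"
  have le1: "Re l \<le> Re u" and le2: "Im l \<le> Im u"
    using le[of 1] le[of \<i>] by (auto simp: Basis_complex_def)
  have vimage: "(\<lambda>x. Complex (fst x) (snd x)) -` box l u \<inter> space (lborel \<Otimes>\<^sub>M lborel)
      = {Re l <..< Re u} \<times> {Im l <..< Im u}"
    by (auto simp: in_box_complex_iff space_pair_measure)
  show "emeasure (distr (lborel \<Otimes>\<^sub>M lborel) borel (\<lambda>(x, y). Complex x y)) (box l u)
      = ennreal (\<Prod>b\<in>Basis. (u - l) \<bullet> b)"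
    by (subst emeasure_distr)
       (use le1 le2 in \<open>auto simp: vimage lborel.emeasure_pair_measure_Times Basis_complex_def
          ennreal_mult split_beta'\<close>)
qed auto

lemma nn_integral_lborel_complex:
  assumes [measurable]: "f \<in> borel_measurable borel"
  shows "(\<integral>\<^sup>+z. f z \<partial>lborel) = (\<integral>\<^sup>+x. \<integral>\<^sup>+y. f (Complex x y) \<partial>lborel \<partial>lborel)"
  by (subst lborel_complex_eq)
     (simp add: nn_integral_distr lborel.nn_integral_fst[symmetric] split_beta')

lemma nn_integral_swap_real:
  fixes f :: "real \<Rightarrow> real \<Rightarrow> ennreal"
  assumes [measurable]: "(\<lambda>(x, y). f x y) \<in> borel_measurable (lborel \<Otimes>\<^sub>M lborel)"
  shows "(\<integral>\<^sup>+x. \<integral>\<^sup>+y. f x y \<partial>lborel \<partial>lborel) = (\<integral>\<^sup>+y. \<integral>\<^sup>+x. f x y \<partial>lborel \<partial>lborel)"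
  using lborel_pair.Fubini'[of f] by simp

text \<open>Since \<open>c \<noteq> 0\<close>, the rotation factors into a substitution of the first coordinate followed by one of the second.\<close>

lemma nn_integral_rotation_aux:
  fixes c s :: real
  assumes [measurable]: "f \<in> borel_measurable borel" and cs: "c\<^sup>2 + s\<^sup>2 = 1" and c: "c \<noteq> 0"
  shows "(\<integral>\<^sup>+z. f (Complex c s * z) \<partial>lborel) = (\<integral>\<^sup>+z. f z \<partial>lborel)"
proof -
  have *: "s * ((x + s * y) / c) + c * y = (s / c) * x + y / c" for x y
  proof -
    have "s * s + c * c = 1" using cs by (simp add: power2_eq_square)
    then have "s * (s * y) + c * (c * y) = y" by (metis distrib_right mult.assoc mult_1)
    then show ?thesis using c by (simp add: field_simps)
  qed
  have "(\<integral>\<^sup>+z. f (Complex c s * z) \<partial>lborel)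
      = (\<integral>\<^sup>+x. \<integral>\<^sup>+y. f (Complex (c * x - s * y) (s * x + c * y)) \<partial>lborel \<partial>lborel)"
    by (subst nn_integral_lborel_complex) (auto simp: complex_mult algebra_simps)
  also have "\<dots> = (\<integral>\<^sup>+y. \<integral>\<^sup>+x. f (Complex (c * x - s * y) (s * x + c * y)) \<partial>lborel \<partial>lborel)"
    by (rule nn_integral_swap_real) simp
  also have "\<dots> = (\<integral>\<^sup>+y. \<bar>1/c\<bar> * (\<integral>\<^sup>+x. f (Complex x ((s / c) * x + y / c)) \<partial>lborel) \<partial>lborel)"
  proof (rule nn_integral_cong)
    fix y :: real
    have "(\<integral>\<^sup>+x. f (Complex (c * x - s * y) (s * x + c * y)) \<partial>lborel)
       = \<bar>1/c\<bar> * (\<integral>\<^sup>+x. f (Complex (c * (s * y / c + 1/c * x) - s * y) (s * (s * y / c + 1/c * x) + c * y)) \<partial>lborel)"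
      by (rule nn_integral_real_affine) (use c in auto)
    also have "\<dots> = \<bar>1/c\<bar> * (\<integral>\<^sup>+x. f (Complex x ((s / c) * x + y / c)) \<partial>lborel)"
    proof -
      have "Complex (c * (s * y / c + 1/c * x) - s * y) (s * (s * y / c + 1/c * x) + c * y)
          = Complex x ((s / c) * x + y / c)" for x
        using *[of x y] c by (simp add: add_divide_distrib add.commute distrib_left)
      then show ?thesis by simp
    qed
    finally show "(\<integral>\<^sup>+x. f (Complex (c * x - s * y) (s * x + c * y)) \<partial>lborel) = \<dots>" .
  qed
  also have "\<dots> = (\<integral>\<^sup>+y. \<integral>\<^sup>+x. \<bar>1/c\<bar> * f (Complex x ((s / c) * x + y / c)) \<partial>lborel \<partial>lborel)"
    by (intro nn_integral_cong nn_integral_cmult[symmetric]) auto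
  also have "\<dots> = (\<integral>\<^sup>+x. \<integral>\<^sup>+y. \<bar>1/c\<bar> * f (Complex x ((s / c) * x + y / c)) \<partial>lborel \<partial>lborel)"
    by (rule nn_integral_swap_real) simp
  also have "\<dots> = (\<integral>\<^sup>+x. \<bar>1/c\<bar> * (\<integral>\<^sup>+y. f (Complex x ((s / c) * x + y / c)) \<partial>lborel) \<partial>lborel)"
    by (intro nn_integral_cong nn_integral_cmult) auto
  also have "\<dots> = (\<integral>\<^sup>+x. \<integral>\<^sup>+y. f (Complex x y) \<partial>lborel \<partial>lborel)"
  proof (rule nn_integral_cong)
    fix x :: real
    show "\<bar>1/c\<bar> * (\<integral>\<^sup>+y. f (Complex x ((s / c) * x + y / c)) \<partial>lborel)
        = (\<integral>\<^sup>+y. f (Complex x y) \<partial>lborel)"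
      using c by (subst nn_integral_real_affine[of "\<lambda>y. f (Complex x y)" "1/c" "(s / c) * x"]) auto
  qed
  also have "\<dots> = (\<integral>\<^sup>+z. f z \<partial>lborel)"
    by (rule nn_integral_lborel_complex[symmetric]) simp
  finally show ?thesis .
qed

lemma nn_integral_rotation:
  assumes [measurable]: "f \<in> borel_measurable borel" and z: "cmod \<zeta> = 1"
  shows "(\<integral>\<^sup>+z. f (\<zeta> * z) \<partial>lborel) = (\<integral>\<^sup>+z. f z \<partial>lborel)"
proof (cases "Re \<zeta> = 0")
  case False
  then show ?thesis
    using nn_integral_rotation_aux[of f "Re \<zeta>" "Im \<zeta>"] z
    by (simp add: cmod_def real_sqrt_eq_1_iff)
next
  case True
  \<comment> \<open>A purely imaginary \<open>\<zeta>\<close> violates the condition c \<noteq> 0,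
    so it is split into two rotations with nonzero real part. The Pythagorean point (3 + 4 i) / 5
    serves, as it leaves Re \<open>\<xi>\<close> = 4/5 * Im \<open>\<zeta>\<close>.\<close>
  define \<xi> where "\<xi> = Complex (3/5) (-4/5) * \<zeta>"
  have "\<zeta> = Complex (3/5) (4/5) * \<xi>"
    by (simp add: \<xi>_def complex_eq_iff algebra_simps)
  then have "(\<integral>\<^sup>+z. f (\<zeta> * z) \<partial>lborel) = (\<integral>\<^sup>+z. f (Complex (3/5) (4/5) * (\<xi> * z)) \<partial>lborel)"
    by (simp only: mult.assoc)
  also have "\<dots> = (\<integral>\<^sup>+z. f (Complex (3/5) (4/5) * z) \<partial>lborel)"
  proof -
    have "Im \<zeta> \<noteq> 0" "(Im \<zeta>)\<^sup>2 = 1" using True z by (auto simp: cmod_def abs_square_eq_1 power2_eq_1_iff)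
    then have "Re \<xi> \<noteq> 0" "(Re \<xi>)\<^sup>2 + (Im \<xi>)\<^sup>2 = 1"
      using True by (auto simp: \<xi>_def power_mult_distrib power_divide)
    from nn_integral_rotation_aux[of "\<lambda>z. f (Complex (3/5) (4/5) * z)", OF _ this(2,1)]
    show ?thesis by simp
  qed
  also have "\<dots> = (\<integral>\<^sup>+z. f z \<partial>lborel)"
    by (rule nn_integral_rotation_aux) (auto simp: power_divide)
  finally show ?thesis .
qed

lemma lborel_distr_rotation:
  assumes "cmod \<zeta> = 1"
  shows "distr lborel borel ((*) \<zeta>) = lborel"
proof (rule measure_eqI)
  fix A assume "A \<in> sets (distr lborel borel ((*) \<zeta>))"
  then have [measurable]: "A \<in> sets borel" by simp
  have "emeasure (distr lborel borel ((*) \<zeta>)) A = (\<integral>\<^sup>+z. indicator A z \<partial>distr lborel borel ((*) \<zeta>))"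
    by simp
  also have "\<dots> = (\<integral>\<^sup>+z. indicator A (\<zeta> * z) \<partial>lborel)"
    by (subst nn_integral_distr) auto
  also have "\<dots> = (\<integral>\<^sup>+z. indicator A z \<partial>lborel)"
    by (rule nn_integral_rotation) (use assms in auto)
  finally show "emeasure (distr lborel borel ((*) \<zeta>)) A = emeasure lborel A" by simp
qed simp

text \<open>Rays are parametrized by their slope \<open>t\<close> and points on a ray by their real part \<open>x\<close>.\<close>

lemma half_plane_polar:
  "density lborel (\<lambda>z. indicator {0<..} (Re z)) =
   distr (density (lborel \<Otimes>\<^sub>M lborel) (\<lambda>(t, x). ennreal (indicator {0<..} x * x))) borel
     (\<lambda>(t, x). Complex x (x * t))" (is "?M = ?N")
proof (rule measure_eqI)
  fix A assume "A \<in> sets ?M"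
  then have [measurable]: "A \<in> sets borel" by simp
  have "emeasure ?M A = (\<integral>\<^sup>+z. indicator {0<..} (Re z) * indicator A z \<partial>lborel)"
    by (subst emeasure_density) auto
  also have "\<dots> = (\<integral>\<^sup>+x. \<integral>\<^sup>+y. indicator {0<..} x * indicator A (Complex x y) \<partial>lborel \<partial>lborel)"
    by (subst nn_integral_lborel_complex) auto
  also have "\<dots> = (\<integral>\<^sup>+x. \<integral>\<^sup>+t. ennreal (indicator {0<..} x * x) * indicator A (Complex x (x * t)) \<partial>lborel \<partial>lborel)"
  proof (rule nn_integral_cong)
    fix x :: real
    show "(\<integral>\<^sup>+y. indicator {0<..} x * indicator A (Complex x y) \<partial>lborel)
        = (\<integral>\<^sup>+t. ennreal (indicator {0<..} x * x) * indicator A (Complex x (x * t)) \<partial>lborel)"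
    proof (cases "x > 0")
      case True
      then show ?thesis
        by (subst nn_integral_real_affine[of _ x 0]) (auto simp: nn_integral_cmult)
    qed auto
  qed
  also have "\<dots> = (\<integral>\<^sup>+t. \<integral>\<^sup>+x. ennreal (indicator {0<..} x * x) * indicator A (Complex x (x * t)) \<partial>lborel \<partial>lborel)"
    by (rule nn_integral_swap_real) simp
  also have "\<dots> = (\<integral>\<^sup>+p. ennreal (indicator {0<..} (snd p) * snd p) * indicator A (Complex (snd p) (snd p * fst p)) \<partial>(lborel \<Otimes>\<^sub>M lborel))"
    by (subst lborel.nn_integral_fst[symmetric]) auto
  also have "\<dots> = (\<integral>\<^sup>+z. indicator A z \<partial>?N)"
    by (subst nn_integral_distr) (auto simp: nn_integral_density split_beta')
  finally show "emeasure ?M A = emeasure ?N A" by simp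
qed simp

section \<open>The distribution of the modulus on the unit disc\<close>

lemma measurable_indicator_cball [measurable]:
  "(indicator (cball a r) :: _ \<Rightarrow> _ :: {topological_space, zero_neq_one}) \<in> borel_measurable borel"
  by (rule borel_measurable_indicator) simp

text \<open>Two measures on the line that are finite and equal on all half-lines
  \<open>{x<..}\<close> coincide, so only the areas of annuli are needed.\<close>

lemma distr_cmod_unit_disc:
  "distr (density lborel (indicator (cball (0::complex) 1))) borel cmod
     = density lborel (\<lambda>r. ennreal (indicator {0..1} r * (2 * pi * r)))" (is "?M = ?N")
proof (rule measure_eqI_lessThan)
  have disc: "emeasure lborel (cball (0::complex) r) = ennreal (pi * r\<^sup>2)" if "r \<ge> 0" for r
    using that by (simp add: emeasure_cball unit_ball_vol_2)
  have M: "emeasure ?M {x<..} = emeasure lborel (cball 0 1 - cball (0::complex) x)" for x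
  proof -
    have "emeasure ?M {x<..} = (\<integral>\<^sup>+z. indicator (cball 0 1) z * indicator {z. x < cmod z} z \<partial>lborel)"
      by (subst emeasure_distr, simp, simp, subst emeasure_density)
        (auto simp: vimage_def measurable_indicator_cball)
    also have "\<dots> = (\<integral>\<^sup>+z. indicator (cball 0 1 - cball (0::complex) x) z \<partial>lborel)"
      by (rule nn_integral_cong) (auto simp: indicator_def)
    finally show ?thesis by simp
  qed
  show "emeasure ?M {x<..} < \<infinity>" for x
  proof -
    have "emeasure ?M {x<..} \<le> emeasure lborel (cball (0::complex) 1)"
      unfolding M by (rule emeasure_mono) auto
    also have "\<dots> < \<infinity>" by (simp add: disc)
    finally show ?thesis .
  qed
  show "emeasure ?M {x<..} = emeasure ?N {x<..}" for x :: real
  proof -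
    \<comment> \<open>Clamping x to [0, 1] makes pi (1 - m^2) the right area in all three cases x <
      0, 0 \<le> x < 1 and x \<ge> 1.\<close>
    define m where "m = max 0 (min 1 x)"
    have m: "0 \<le> m" "m \<le> 1" by (auto simp: m_def)
    have "emeasure ?N {x<..} = (\<integral>\<^sup>+r. ennreal (indicator {0..1} r * (2 * pi * r)) * indicator {x<..} r \<partial>lborel)"
      by (subst emeasure_density) auto
    also have "\<dots> = (\<integral>\<^sup>+r. ennreal (2 * pi * r) * indicator {m..1} r \<partial>lborel)"
      by (rule nn_integral_cong_AE, rule AE_mp[OF AE_lborel_singleton[of x]], rule AE_mp[OF AE_lborel_singleton[of 1]])
         (auto simp: m_def max_def min_def indicator_def split: if_splits)
    also have "\<dots> = ennreal (pi * 1\<^sup>2 - pi * m\<^sup>2)"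
      by (rule nn_integral_FTC_Icc[where F = "\<lambda>r. pi * r\<^sup>2"])
         (use m in \<open>auto intro!: derivative_eq_intros\<close>)
    also have "\<dots> = emeasure lborel (cball 0 1 - cball (0::complex) x)"
    proof (cases "x < 0")
      case True
      then show ?thesis using disc[of 1] by (auto simp: m_def)
    next
      case False
      show ?thesis
      proof (cases "x \<ge> 1")
        case True
        then have *: "cball 0 1 - cball (0::complex) x = {}" and "m = 1" by (auto simp: m_def)
        then show ?thesis unfolding * by simp
      next
        case F: False
        have "m = x" using False F by (auto simp: m_def)
        have "emeasure lborel (cball 0 1 - cball (0::complex) x) =
          emeasure lborel (cball (0::complex) 1) - emeasure lborel (cball (0::complex) x)"
          by (rule emeasure_Diff) (use F False disc[of x] in auto)
        also have "\<dots> = ennreal (pi * 1\<^sup>2) - ennreal (pi * x\<^sup>2)"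
          using False by (subst (1 2) disc) auto
        also have "\<dots> = ennreal (pi * 1\<^sup>2 - pi * x\<^sup>2)"
          by (rule ennreal_minus) simp
        finally show ?thesis using \<open>m = x\<close> by simp
      qed
    qed
    finally show ?thesis by (simp add: M)
  qed
qed auto

section \<open>The logarithmic mean over the unit disc\<close>

text \<open>The triangle inequality reduces the lower bound to reals a \<ge> b \<ge> 0, where a^M -
  b^M \<ge> a^(M-1) (a - b) because b^M \<le> a^(M-1) b.\<close>

lemma cmod_power_diff_bounds:
  fixes w y :: complex
  assumes "0 < cmod w" "cmod y \<noteq> cmod w" "0 < M"
  defines "m \<equiv> max (cmod w) (cmod y)"
  shows "m ^ (M - 1) * \<bar>cmod w - cmod y\<bar> \<le> cmod (w ^ M - y ^ M)"
    and "cmod (w ^ M - y ^ M) \<le> 2 * m ^ M"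
proof -
  have *: "a ^ (M - 1) * (a - b) \<le> a ^ M - b ^ M" if "0 \<le> b" "b \<le> a" for a b :: real
  proof -
    have "b ^ (M - 1) * b \<le> a ^ (M - 1) * b"
      using that by (intro mult_right_mono power_mono) auto
    moreover have "a ^ M = a ^ (M - 1) * a" "b ^ M = b ^ (M - 1) * b"
      by (simp_all only: power_minus_mult[OF assms(3)])
    ultimately show ?thesis by (simp add: right_diff_distrib)
  qed
  have 1: "\<bar>cmod w ^ M - cmod y ^ M\<bar> \<le> cmod (w ^ M - y ^ M)"
    using norm_triangle_ineq3[of "w ^ M" "y ^ M"] by (simp add: norm_power)
  show "m ^ (M - 1) * \<bar>cmod w - cmod y\<bar> \<le> cmod (w ^ M - y ^ M)"
  proof (cases "cmod y \<le> cmod w")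
    case True
    then show ?thesis using *[of "cmod y" "cmod w"] 1 by (simp add: m_def max_def)
  next
    case False
    then show ?thesis using *[of "cmod w" "cmod y"] 1 by (simp add: m_def max_def)
  qed
  have "cmod (w ^ M - y ^ M) \<le> cmod w ^ M + cmod y ^ M"
    using norm_triangle_ineq4[of "w ^ M" "y ^ M"] by (simp add: norm_power)
  also have "\<dots> \<le> m ^ M + m ^ M"
    by (intro add_mono power_mono) (auto simp: m_def)
  finally show "cmod (w ^ M - y ^ M) \<le> 2 * m ^ M" by simp
qed

text \<open>In logarithms, the lower bound trades a single ln m for the logarithm of ||w| - |y||,
  and the upper bound adds ln 2; neither change grows with M.\<close>

lemma ln_cmod_power_diff_bound:
  fixes w y :: complex
  assumes "0 < cmod w" "cmod y \<noteq> cmod w" "0 < M"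
  defines "m \<equiv> max (cmod w) (cmod y)"
  shows "\<bar>ln (cmod (w ^ M - y ^ M)) - M * ln m\<bar> \<le> ln 2 + \<bar>ln m\<bar> + \<bar>ln \<bar>cmod w - cmod y\<bar>\<bar>"
proof -
  note b = cmod_power_diff_bounds[OF assms(1-3), folded m_def]
  have m: "m > 0" using assms(1) unfolding m_def by linarith
  have d: "\<bar>cmod w - cmod y\<bar> > 0" using assms by simp
  have pos: "0 < m ^ (M - 1) * \<bar>cmod w - cmod y\<bar>" using m d by simp
  have "ln (m ^ (M - 1) * \<bar>cmod w - cmod y\<bar>) \<le> ln (cmod (w ^ M - y ^ M))"
    using b(1) pos by (subst ln_le_cancel_iff) auto
  then have l: "(real M - 1) * ln m + ln \<bar>cmod w - cmod y\<bar> \<le> ln (cmod (w ^ M - y ^ M))"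
    using m d assms(3) by (simp add: ln_mult ln_realpow of_nat_diff Suc_leI)
  have "ln (cmod (w ^ M - y ^ M)) \<le> ln (2 * m ^ M)"
    using b pos m by (subst ln_le_cancel_iff) auto
  then have u: "ln (cmod (w ^ M - y ^ M)) \<le> ln 2 + M * ln m"
    using m by (simp add: ln_mult ln_realpow)
  have l2: "(0::real) < ln 2" by simp
  show ?thesis using l u l2 unfolding left_diff_distrib mult_1 by linarith
qed

text \<open>Apply ln v \<le> v to v = sqrt u and to v = 1 / sqrt u. The resulting majorant has an
  integrable singularity at 0.\<close>

lemma abs_ln_le_sqrt:
  assumes "(u::real) \<ge> 0"
  shows "\<bar>ln u\<bar> \<le> 2 * sqrt u + 2 * (1 / sqrt u)"
proof (cases "u = 0")
  case False
  then have u: "sqrt u > 0" using assms by simp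
  have "ln (sqrt u) \<le> sqrt u" "ln (1 / sqrt u) \<le> 1 / sqrt u"
    using ln_bound[of "sqrt u"] ln_bound[of "1 / sqrt u"] u by auto
  moreover have "ln (sqrt u) = ln u / 2" using assms False by (simp add: ln_sqrt)
  moreover have "ln (1 / sqrt u) = - (ln u / 2)" using u calculation(3) by (simp add: ln_div)
  moreover have "1 / sqrt u > 0" using u by simp
  ultimately show ?thesis using u by linarith
qed simp

lemma ln_abs_integrable: "set_integrable lborel {a..b} (\<lambda>r::real. ln \<bar>r - c\<bar>)"
proof (cases "a \<le> b")
  case True
  \<comment> \<open>The real \<open>sqrt\<close> is an odd function, so 2 * sqrt (r - c) is a
    primitive on both sides of c and continuous across it.\<close>
  have "((\<lambda>r. 1 / sqrt \<bar>r - c\<bar>) has_integral (2 * sqrt (b - c) - 2 * sqrt (a - c))) {a..b}"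
  proof (rule fundamental_theorem_of_calculus_interior_strong[of "{c}"])
    fix r assume "r \<in> {a<..<b} - {c}"
    then have "r \<noteq> c" by auto
    then have "(sqrt has_real_derivative 1 / (2 * sqrt \<bar>r - c\<bar>)) (at (r - c))"
      by (intro DERIV_real_sqrt_generic) (auto simp: field_simps abs_if real_sqrt_minus[symmetric])
    then have "((\<lambda>r. sqrt (r - c)) has_real_derivative 1 / (2 * sqrt \<bar>r - c\<bar>) * 1) (at r)"
      by (rule DERIV_chain2) (auto intro!: derivative_eq_intros)
    from DERIV_cmult[OF this, of 2]
    show "((\<lambda>r. 2 * sqrt (r - c)) has_vector_derivative 1 / sqrt \<bar>r - c\<bar>) (at r)"
      by (simp flip: has_real_derivative_iff_has_vector_derivative)
  qed (use True in \<open>auto intro!: continuous_intros\<close>)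
  then have "(\<lambda>r. 1 / sqrt \<bar>r - c\<bar>) absolutely_integrable_on {a..b}"
    by (intro nonnegative_absolutely_integrable_1) auto
  then have "set_integrable lborel {a..b} (\<lambda>r. 1 / sqrt \<bar>r - c\<bar>)"
    unfolding set_integrable_def by (subst (asm) integrable_completion) auto
  moreover have "set_integrable lborel {a..b} (\<lambda>r. sqrt \<bar>r - c\<bar>)"
    by (intro borel_integrable_atLeastAtMost') (auto intro!: continuous_intros)
  ultimately have "set_integrable lborel {a..b} (\<lambda>r. 2 * sqrt \<bar>r - c\<bar> + 2 * (1 / sqrt \<bar>r - c\<bar>))"
    by (intro set_integral_add set_integrable_mult_right) auto
  then show ?thesis
  proof (rule set_integrable_bound)
    show "AE x in lborel. x \<in> {a..b} \<longrightarrow> norm (ln \<bar>x - c\<bar>) \<le> norm (2 * sqrt \<bar>x - c\<bar> + 2 * (1 / sqrt \<bar>x - c\<bar>))"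
    proof (intro AE_I2 impI)
      fix x
      have "0 \<le> 2 * sqrt \<bar>x - c\<bar> + 2 * (1 / sqrt \<bar>x - c\<bar>)" by simp
      then show "norm (ln \<bar>x - c\<bar>) \<le> norm (2 * sqrt \<bar>x - c\<bar> + 2 * (1 / sqrt \<bar>x - c\<bar>))"
        using abs_ln_le_sqrt[of "\<bar>x - c\<bar>"] by simp
    qed
  qed (simp add: set_borel_measurable_def)
qed (simp add: set_integrable_def)

lemma
  fixes F :: "real \<Rightarrow> real"
  assumes [measurable]: "F \<in> borel_measurable borel"
  shows integrable_radial:
      "set_integrable lborel (cball (0::complex) 1) (\<lambda>y. F (cmod y)) \<longleftrightarrow>
       set_integrable lborel {0..1} (\<lambda>r. r * F r)" (is ?A)
    and integral_radial:
      "(LINT y:cball (0::complex) 1|lborel. F (cmod y)) = 2 * pi * (LINT r:{0..1}|lborel. r * F r)" (is ?B)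
proof -
  have *: "distr (density lborel (\<lambda>z. ennreal (indicator (cball (0::complex) 1) z))) borel cmod
     = density lborel (\<lambda>r. ennreal (indicator {0..1} r * (2 * pi * r)))"
    using distr_cmod_unit_disc by (simp add: ennreal_indicator)
  have nn: "AE r in lborel. 0 \<le> indicator {0..1} r * (2 * pi * r)"
    by (auto simp: indicator_def)
  have **: "(\<lambda>r. indicator {0..1} r * (2 * pi * r) * F r) = (\<lambda>r. 2 * pi * (indicator {0..1} r * (r * F r)))"
    by (auto simp: fun_eq_iff)
  have "integrable lborel (\<lambda>y. indicator (cball (0::complex) 1) y *\<^sub>R F (cmod y)) \<longleftrightarrow>
     integrable (distr (density lborel (\<lambda>z. ennreal (indicator (cball (0::complex) 1) z))) borel cmod) F"
    by (subst integrable_distr_eq, simp, simp, subst integrable_density) auto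
  also have "\<dots> \<longleftrightarrow> integrable lborel (\<lambda>r. 2 * pi * (indicator {0..1} r * (r * F r)))"
    unfolding * by (subst integrable_real_density) (use nn ** in auto)
  finally show ?A by (simp add: set_integrable_def)
  have "(\<integral>y. indicator (cball (0::complex) 1) y *\<^sub>R F (cmod y) \<partial>lborel)
     = (\<integral>r. F r \<partial>distr (density lborel (\<lambda>z. ennreal (indicator (cball (0::complex) 1) z))) borel cmod)"
    by (subst integral_distr, simp, simp, subst integral_density) auto
  also have "\<dots> = (\<integral>r. 2 * pi * (indicator {0..1} r * (r * F r)) \<partial>lborel)"
    unfolding * by (subst integral_real_density) (use nn ** in auto)
  finally show ?B by (simp add: set_lebesgue_integral_def)
qed

text \<open>Circles are null sets. All zeros y of w^M - y^M lie on the circle |y| = |w|, which may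
  therefore be discarded.\<close>

lemma AE_cmod_neq: "AE y in lborel. cmod y \<noteq> R"
proof -
  have "{y. cmod y = R} \<in> null_sets lborel"
  proof -
    have "sphere (0::complex) R \<in> null_sets lebesgue"
      using negligible_sphere[of "0::complex" R] by (simp add: negligible_iff_null_sets)
    moreover have "sphere (0::complex) R = {y. cmod y = R}" by auto
    ultimately show ?thesis
      by (metis closed_sphere borel_closed null_sets_completion_iff sets_lborel)
  qed
  then show ?thesis by (rule AE_I') auto
qed

definition disc_log :: "real \<Rightarrow> real" where
  "disc_log R = (if R \<ge> 1 then ln R else (R\<^sup>2 - 1) / 2)"

text \<open>When |w| = R, the value ln (max R r) is the mean of ln |w - y| over the circle |y| = r,
  which makes this integrand the right comparison function. Being radial, it reduces to a real
  integral.\<close>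

lemma integral_disc_ln_max:
  assumes "R > 0"
  shows "set_integrable lborel (cball (0::complex) 1) (\<lambda>y. ln (max R (cmod y)))"
    and "(LINT y:cball (0::complex) 1|lborel. ln (max R (cmod y))) = pi * disc_log R"
proof -
  have cont: "continuous_on {0..1} (\<lambda>r. r * ln (max R r))"
    using assms by (auto intro!: continuous_intros)
  then have int: "set_integrable lborel {0..1} (\<lambda>r. r * ln (max R r))"
    by (intro borel_integrable_atLeastAtMost') auto
  then show "set_integrable lborel (cball (0::complex) 1) (\<lambda>y. ln (max R (cmod y)))"
    by (subst integrable_radial[of "\<lambda>r. ln (max R r)"]) auto
  \<comment> \<open>The constant R^2 / 4 makes the two branches of this primitive meet at r =
    R.\<close>
  define G where "G r = (if r \<le> R then r\<^sup>2 / 2 * ln R else r\<^sup>2 / 2 * ln r - r\<^sup>2 / 4 + R\<^sup>2 / 4)" for r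
  have "((\<lambda>r. r * ln (max R r)) has_integral (G 1 - G 0)) {0..1}"
  proof (rule fundamental_theorem_of_calculus_interior_strong[of "{R}"])
    have "continuous_on ({0..R} \<union> {R..max R 1}) G"
      unfolding G_def using assms
      by (intro continuous_on_If) (auto intro!: continuous_intros)
    then show "continuous_on {0..1} G"
      by (rule continuous_on_subset) auto
    show "(G has_vector_derivative r * ln (max R r)) (at r)" if "r \<in> {0<..<1} - {R}" for r
    proof (cases "r < R")
      case True
      have "((\<lambda>r. r\<^sup>2 / 2 * ln R) has_real_derivative r * ln R) (at r)"
        by (auto intro!: derivative_eq_intros)
      then have "(G has_real_derivative r * ln R) (at r)"
        by (rule has_field_derivative_transform_within_open[where S = "{..<R}"]) (use True in \<open>auto simp: G_def\<close>)
      then show ?thesis using True by (simp add: has_real_derivative_iff_has_vector_derivative max_def)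
    next
      case False
      have "((\<lambda>r. r\<^sup>2 / 2 * ln r - r\<^sup>2 / 4 + R\<^sup>2 / 4) has_real_derivative r * ln r) (at r)"
        using that by (auto intro!: derivative_eq_intros simp: field_simps power2_eq_square)
      then have "(G has_real_derivative r * ln r) (at r)"
        by (rule has_field_derivative_transform_within_open[where S = "{R<..}"]) (use False that in \<open>auto simp: G_def\<close>)
      then show ?thesis using False by (simp add: has_real_derivative_iff_has_vector_derivative max_def)
    qed
  qed auto
  moreover have "G 1 - G 0 = disc_log R / 2"
    using assms by (auto simp: G_def disc_log_def field_simps)
  moreover have "(LINT r:{0..1}|lborel. r * ln (max R r)) = integral {0..1} (\<lambda>r. r * ln (max R r))"
    by (rule set_borel_integral_eq_integral) (rule int)
  ultimately have "(LINT r:{0..1}|lborel. r * ln (max R r)) = disc_log R / 2"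
    by (simp add: integral_unique)
  then show "(LINT y:cball (0::complex) 1|lborel. ln (max R (cmod y))) = pi * disc_log R"
    by (subst integral_radial[of "\<lambda>r. ln (max R r)"]) auto
qed

lemma integrable_disc_ln_cmod_power_diff:
  assumes "w \<noteq> 0" "0 < M"
  shows "set_integrable lborel (cball (0::complex) 1) (\<lambda>y. ln (cmod (w ^ M - y ^ M)))"
    and "\<bar>(LINT y:cball 0 1|lborel. ln (cmod (w ^ M - y ^ M))) - M * (pi * disc_log (cmod w))\<bar>
       \<le> (LINT y:cball (0::complex) 1|lborel. ln 2 + \<bar>ln (max (cmod w) (cmod y))\<bar> + \<bar>ln \<bar>cmod w - cmod y\<bar>\<bar>)"
proof -
  let ?D = "cball (0::complex) 1"
  let ?f = "\<lambda>y. ln (cmod (w ^ M - y ^ M))"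
  let ?m = "\<lambda>y. ln (max (cmod w) (cmod y))"
  let ?B = "\<lambda>y. ln 2 + \<bar>?m y\<bar> + \<bar>ln \<bar>cmod w - cmod y\<bar>\<bar>"
  have w: "cmod w > 0" using assms by simp
  have D: "emeasure lborel ?D < \<infinity>" using emeasure_lborel_cball_finite[of "0::complex" 1] by (simp add: less_top)
  note m = integral_disc_ln_max[OF w]
  have "set_integrable lborel {0..1} (\<lambda>r. r * ln \<bar>cmod w - r\<bar>)"
  proof (rule set_integrable_bound)
    show "set_integrable lborel {0..1} (\<lambda>r. ln \<bar>r - cmod w\<bar>)" by (rule ln_abs_integrable)
    show "AE r in lborel. r \<in> {0..1} \<longrightarrow> norm (r * ln \<bar>cmod w - r\<bar>) \<le> norm (ln \<bar>r - cmod w\<bar>)"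
      by (auto simp: abs_mult abs_minus_commute intro!: mult_left_le_one_le)
  qed (simp add: set_borel_measurable_def)
  then have "set_integrable lborel ?D (\<lambda>y. ln \<bar>cmod w - cmod y\<bar>)"
    by (subst integrable_radial[of "\<lambda>r. ln \<bar>cmod w - r\<bar>"]) auto
  moreover have "set_integrable lborel ?D (\<lambda>y. ln 2 :: real)"
    using D by (simp add: set_integrable_def)
  ultimately have B: "set_integrable lborel ?D ?B"
    using m(1) by (intro set_integral_add set_integrable_abs) auto
  have bound: "AE y in lborel. \<bar>?f y - M * ?m y\<bar> \<le> ?B y"
    using AE_cmod_neq[of "cmod w"]
    by eventually_elim (use ln_cmod_power_diff_bound[OF w _ assms(2)] in auto)
  have diff: "set_integrable lborel ?D (\<lambda>y. ?f y - M * ?m y)"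
  proof (rule set_integrable_bound[OF B])
    show "AE y in lborel. y \<in> ?D \<longrightarrow> norm (?f y - M * ?m y) \<le> norm (?B y)"
      using bound by eventually_elim (simp only: real_norm_def order_trans[OF _ abs_ge_self] simp_thms)
  qed (simp add: set_borel_measurable_def)
  \<comment> \<open>Adding the integrable M ln (max |w| |y|) back to the dominated difference gives
    integrability of the singular function itself.\<close>
  have "set_integrable lborel ?D (\<lambda>y. (?f y - M * ?m y) + M * ?m y)"
    by (intro set_integral_add set_integrable_mult_right diff m)
  then show f: "set_integrable lborel ?D ?f" by simp
  have "\<bar>(LINT y:?D|lborel. ?f y - M * ?m y)\<bar> \<le> (LINT y:?D|lborel. ?B y)"
    unfolding set_lebesgue_integral_def
  proof (intro order_trans[OF integral_abs_bound] integral_mono_AE)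
    show "AE y in lborel. \<bar>indicat_real ?D y *\<^sub>R (?f y - M * ?m y)\<bar> \<le> indicat_real ?D y *\<^sub>R ?B y"
    proof -
      have "\<bar>indicat_real ?D y *\<^sub>R u\<bar> \<le> indicat_real ?D y *\<^sub>R v" if "\<bar>u\<bar> \<le> v" for u v :: real and y
        using that by (cases "y \<in> ?D") simp_all
      then show ?thesis
        using bound by (rule eventually_mono[rotated])
    qed
  qed (use diff B in \<open>auto simp: set_integrable_def\<close>)
  moreover have "(LINT y:?D|lborel. ?f y - M * ?m y) = (LINT y:?D|lborel. ?f y) - M * (pi * disc_log (cmod w))"
    using f m by (simp add: set_integral_diff)
  ultimately show "\<bar>(LINT y:?D|lborel. ?f y) - M * (pi * disc_log (cmod w))\<bar> \<le> (LINT y:?D|lborel. ?B y)"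
    by simp
qed

text \<open>The two factors of \<open>w^(2M) - y^(2M)\<close> have the same logarithmic mean, since \<open>y \<mapsto> cis (pi / M) * y\<close> swaps them.\<close>

lemma integral_disc_ln_double:
  assumes "w \<noteq> 0" "0 < M"
  shows "(LINT y:cball 0 1|lborel. ln (cmod (w ^ (2 * M) - y ^ (2 * M))))
       = 2 * (LINT y:cball 0 1|lborel. ln (cmod (w ^ M - y ^ M)))"
proof -
  let ?D = "cball (0::complex) 1"
  define \<zeta> where "\<zeta> = cis (pi / M)"
  have \<zeta>: "cmod \<zeta> = 1" "\<zeta> ^ M = -1"
    using assms unfolding \<zeta>_def Complex.DeMoivre by (auto simp flip: cis_pi)
  let ?F = "\<lambda>y. indicator ?D y *\<^sub>R ln (cmod (w ^ M - y ^ M))"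
  let ?G = "\<lambda>y. indicator ?D y *\<^sub>R ln (cmod (w ^ M + y ^ M))"
  have rot: "?F (\<zeta> * y) = ?G y" for y
    using \<zeta> by (auto simp: indicator_def norm_mult power_mult_distrib)
  have F: "integrable lborel ?F"
    using integrable_disc_ln_cmod_power_diff(1)[OF assms] by (simp add: set_integrable_def)
  have G: "integrable lborel ?G"
  proof -
    have "integrable (distr lborel borel ((*) \<zeta>)) ?F" using F lborel_distr_rotation[OF \<zeta>(1)] by simp
    then have "integrable lborel (\<lambda>y. ?F (\<zeta> * y))" by (subst (asm) integrable_distr_eq) auto
    then show ?thesis by (simp only: rot)
  qed
  have "integral\<^sup>L lborel ?F = integral\<^sup>L (distr lborel borel ((*) \<zeta>)) ?F"
    using lborel_distr_rotation[OF \<zeta>(1)] by simp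
  also have "\<dots> = integral\<^sup>L lborel (\<lambda>y. ?F (\<zeta> * y))" by (rule integral_distr) auto
  finally have eq: "integral\<^sup>L lborel ?F = integral\<^sup>L lborel ?G" by (simp only: rot)
  have "(LINT y:?D|lborel. ln (cmod (w ^ (2 * M) - y ^ (2 * M)))) = integral\<^sup>L lborel (\<lambda>y. ?F y + ?G y)"
    unfolding set_lebesgue_integral_def
  proof (rule integral_cong_AE)
    show "AE y in lborel. indicat_real ?D y *\<^sub>R ln (cmod (w ^ (2 * M) - y ^ (2 * M))) = ?F y + ?G y"
      using AE_cmod_neq[of "cmod w"]
    proof eventually_elim
      case (elim y)
      \<comment> \<open>Off the circle |y| = |w| both factors are nonzero, as the product rule for
        \<open>ln\<close> requires.\<close>
      have "cmod y ^ M \<noteq> cmod w ^ M"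
        using elim assms(2) by (metis norm_ge_zero power_eq_imp_eq_base)
      then have "w ^ M \<noteq> y ^ M" "w ^ M \<noteq> - (y ^ M)"
        by (metis norm_power, metis norm_minus_cancel norm_power)
      then have "w ^ M - y ^ M \<noteq> 0" "w ^ M + y ^ M \<noteq> 0" by (auto simp: add_eq_0_iff2)
      moreover have "w ^ (2 * M) - y ^ (2 * M) = (w ^ M - y ^ M) * (w ^ M + y ^ M)"
        by (simp add: power_mult[of _ M 2] mult.commute[of 2 M] power2_eq_square algebra_simps)
      ultimately have "ln (cmod (w ^ (2 * M) - y ^ (2 * M))) = ln (cmod (w ^ M - y ^ M)) + ln (cmod (w ^ M + y ^ M))"
        by (simp add: norm_mult ln_mult)
      then show ?case by (simp add: algebra_simps)
    qed
  qed auto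
  also have "\<dots> = 2 * integral\<^sup>L lborel ?F"
    using F G eq by (subst Bochner_Integration.integral_add) auto
  finally show ?thesis by (simp add: set_lebesgue_integral_def)
qed

text \<open>The error in replacing \<open>ln |w^M - y^M|\<close> by \<open>M ln (max |w| |y|)\<close> is bounded independently of \<open>M\<close>,
  while both integrals scale by \<open>M\<close> along \<open>M = 2^n\<close>; so the error vanishes.\<close>

lemma integral_disc_ln_cmod_diff:
  assumes "w \<noteq> 0"
  shows "(LINT y:cball 0 1|lborel. ln (cmod (w - y))) = pi * disc_log (cmod w)"
proof -
  let ?I = "\<lambda>M. LINT y:cball (0::complex) 1|lborel. ln (cmod (w ^ M - y ^ M))"
  define K where "K = (LINT y:cball (0::complex) 1|lborel. ln 2 + \<bar>ln (max (cmod w) (cmod y))\<bar> + \<bar>ln \<bar>cmod w - cmod y\<bar>\<bar>)"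
  have pow: "?I (2 ^ n) = 2 ^ n * ?I 1" for n
  proof (induction n)
    case (Suc n)
    then show ?case using integral_disc_ln_double[OF assms, of "2 ^ n"] by simp
  qed simp
  have "\<bar>?I 1 - pi * disc_log (cmod w)\<bar> \<le> K / 2 ^ n" for n
  proof -
    have "\<bar>2 ^ n * (?I 1 - pi * disc_log (cmod w))\<bar> \<le> K"
      using integrable_disc_ln_cmod_power_diff(2)[OF assms, of "2 ^ n"] pow[of n]
      by (simp add: K_def right_diff_distrib mult_ac)
    then show ?thesis by (simp only: abs_mult) (simp add: field_simps)
  qed
  moreover have "(\<lambda>n. K / 2 ^ n) \<longlonglongrightarrow> 0"
    using tendsto_mult[OF tendsto_const[of K] LIMSEQ_realpow_zero[of "1/2"]]
    by (simp add: power_one_over field_simps)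
  ultimately have "\<bar>?I 1 - pi * disc_log (cmod w)\<bar> \<le> 0"
    by (intro LIMSEQ_le_const[of "\<lambda>n. K / 2 ^ n"]) auto
  then show ?thesis by simp
qed

section \<open>Joint integrability and the reduction to one disc\<close>

lemma disc_log_ge: "R \<ge> 0 \<Longrightarrow> disc_log R \<ge> - 1 / 2"
  using ln_ge_zero[of R] by (auto simp: disc_log_def intro: order_trans[of _ 0])

lemma disc_log_le: "R \<ge> 0 \<Longrightarrow> disc_log R \<le> R"
proof -
  assume "R \<ge> 0"
  show ?thesis
  proof (cases "R \<ge> 1")
    case True
    then show ?thesis using ln_bound[of R] by (simp add: disc_log_def)
  next
    case False
    then have "R\<^sup>2 \<le> 1" using \<open>R \<ge> 0\<close> by (simp add: power_le_one)
    then show ?thesis using False \<open>R \<ge> 0\<close> by (simp add: disc_log_def)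
  qed
qed

lemma measurable_disc_log [measurable]: "disc_log \<in> borel_measurable borel"
  unfolding disc_log_def[abs_def] by measurable

text \<open>The majorant is affine in ln u, so its integral follows from the known integral of the
  logarithm itself. The range up to 4 fits |a| + |x| + |y| \<le> 2 + 1 + 1.\<close>

lemma abs_ln_le: "0 \<le> u \<Longrightarrow> u \<le> 4 \<Longrightarrow> \<bar>ln (u::real)\<bar> \<le> 8 - ln u"
  using ln_bound[of u] by (cases "u = 0") auto

lemma integral_disc_ln_cmod_add:
  assumes "w \<noteq> 0"
  shows "set_integrable lborel (cball 0 1) (\<lambda>y. ln (cmod (w + y)))"
    and "(LINT y:cball 0 1|lborel. ln (cmod (w + y))) = pi * disc_log (cmod w)"
proof -
  have eq: "cmod (- w - y) = cmod (w + y)" for y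
    by (metis minus_add_distrib norm_minus_cancel uminus_add_conv_diff add.commute)
  show "set_integrable lborel (cball 0 1) (\<lambda>y. ln (cmod (w + y)))"
    using integrable_disc_ln_cmod_power_diff(1)[of "- w" 1] assms by (simp add: eq)
  show "(LINT y:cball 0 1|lborel. ln (cmod (w + y))) = pi * disc_log (cmod w)"
    using integral_disc_ln_cmod_diff[of "- w"] assms by (simp add: eq)
qed

text \<open>Fubini's theorem, with joint integrability drawn from a uniform bound on the inner
  integrals of |f|. The condition 1 < |a| keeps a + x nonzero, as the inner mean value formula
  requires; |a| \<le> 2 gives |a + x + y| \<le> 4.\<close>

lemma areal_mahler2_translate_add:
  fixes a :: complex
  assumes a: "1 < cmod a" "cmod a \<le> 2"
  shows "areal_mahler2 (\<lambda>x y. a + x + y) = (1 / pi) * (LINT x:cball 0 1|lborel. disc_log (cmod (a + x)))"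
proof -
  let ?D = "cball (0::complex) 1"
  define f where "f = (\<lambda>z. indicator (?D \<times> ?D) z *\<^sub>R ln (cmod (a + fst z + snd z)))"
  have f_eq: "f (x, y) = indicator ?D x * (indicator ?D y *\<^sub>R ln (cmod (a + x + y)))" for x y
    by (auto simp: f_def indicator_def)
  have fm [measurable]: "f \<in> borel_measurable (lborel \<Otimes>\<^sub>M lborel)"
  proof -
    have "(\<lambda>z. indicator ?D (fst z) * (indicator ?D (snd z) *\<^sub>R ln (cmod (a + fst z + snd z))))
        \<in> borel_measurable (lborel \<Otimes>\<^sub>M lborel)"
      by measurable
    also have "(\<lambda>z. indicator ?D (fst z) * (indicator ?D (snd z) *\<^sub>R ln (cmod (a + fst z + snd z)))) = f"
      by (auto simp: f_eq fun_eq_iff)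
    finally show ?thesis .
  qed
  have nz: "a + x \<noteq> 0" if "x \<in> ?D" for x
    using that a norm_triangle_ineq2[of a "- x"] by (auto simp: add_eq_0_iff2)
  have inner: "integrable lborel (\<lambda>y. f (x, y))"
    "(\<integral>y. f (x, y) \<partial>lborel) = indicator ?D x * (pi * disc_log (cmod (a + x)))" for x
  proof -
    show "integrable lborel (\<lambda>y. f (x, y))"
      using integral_disc_ln_cmod_add(1)[OF nz] by (cases "x \<in> ?D") (auto simp: f_eq set_integrable_def)
    show "(\<integral>y. f (x, y) \<partial>lborel) = indicator ?D x * (pi * disc_log (cmod (a + x)))"
      using integral_disc_ln_cmod_add(2)[OF nz] by (cases "x \<in> ?D") (auto simp: f_eq set_lebesgue_integral_def)
  qed
  have D: "emeasure lborel ?D < \<infinity>" "measure lborel ?D = pi"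
    using emeasure_lborel_cball_finite[of "0::complex" 1]
    by (auto simp: less_top content_cball unit_ball_vol_2)
  \<comment> \<open>The majorant 8 - ln |a + x + y| integrates to 8 pi - pi * disc_log |a + x|, and
    \<open>disc_log\<close> is at least -1/2.\<close>
  have bound: "(\<integral>y. norm (f (x, y)) \<partial>lborel) \<le> 9 * pi * indicator ?D x" for x
  proof (cases "x \<in> ?D")
    case True
    have "(\<integral>y. norm (f (x, y)) \<partial>lborel) \<le> (\<integral>y. indicator ?D y * 8 - f (x, y) \<partial>lborel)"
    proof (rule integral_mono)
      fix y
      show "norm (f (x, y)) \<le> indicator ?D y * 8 - f (x, y)"
      proof (cases "y \<in> ?D")
        case y: True
        have "cmod (a + x + y) \<le> 4"
          using True y a norm_triangle_ineq[of "a + x" y] norm_triangle_ineq[of a x] by auto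
        then show ?thesis using True y abs_ln_le[of "cmod (a + x + y)"] by (simp add: f_eq)
      qed (simp add: f_eq)
    qed (use inner D in \<open>auto intro!: integrable_real_indicator\<close>)
    also have "\<dots> = 8 * pi - pi * disc_log (cmod (a + x))"
      using inner D True by (subst Bochner_Integration.integral_diff) (auto intro!: integrable_real_indicator)
    also have "\<dots> \<le> 8 * pi + pi"
      using mult_left_mono[OF disc_log_ge[of "cmod (a + x)"], of pi] pi_gt_zero by (simp; linarith)
    finally show ?thesis using True by simp
  qed (simp add: f_eq)
  have int: "integrable (lborel \<Otimes>\<^sub>M lborel) f"
  proof (rule lborel_pair.Fubini_integrable)
    show "integrable lborel (\<lambda>x. \<integral>y. norm (f (x, y)) \<partial>lborel)"
    proof (rule Bochner_Integration.integrable_bound)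
      show "integrable lborel (\<lambda>x. 9 * pi * indicator ?D x :: real)"
        using D by (auto intro!: integrable_real_indicator)
    qed (use bound in \<open>auto intro!: AE_I2\<close>)
  qed (use inner in auto)
  have "areal_mahler2 (\<lambda>x y. a + x + y) = (1 / pi\<^sup>2) * (\<integral>z. f z \<partial>lborel)"
    by (simp add: areal_mahler2_def set_lebesgue_integral_def f_def)
  also have "(\<integral>z. f z \<partial>lborel) = (\<integral>x. \<integral>y. f (x, y) \<partial>lborel \<partial>lborel)"
    using lborel_pair.integral_fst'[OF int] by (simp add: lborel_prod)
  also have "\<dots> = pi * (LINT x:?D|lborel. disc_log (cmod (a + x)))"
    by (simp add: inner(2) set_lebesgue_integral_def mult.left_commute[of _ pi])
  finally show ?thesis by (simp add: power2_eq_square)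
qed

section \<open>Polar coordinates on the shifted disc\<close>

lemma integral_disc_log:
  assumes "h \<ge> 0"
  shows "(LINT r:{exp (- h)..exp h}|lborel. r * disc_log r) = sector_integral h"
proof -
  \<comment> \<open>The constant 1/8 makes the two branches of the primitive meet at r = 1, where
    \<open>disc_log\<close> changes its formula.\<close>
  define F where "F r = (if r \<le> 1 then r ^ 4 / 8 - r\<^sup>2 / 4 else r\<^sup>2 / 2 * ln r - r\<^sup>2 / 4 + 1 / 8)" for r :: real
  have cdl: "continuous_on {exp (- h)..exp h} disc_log"
  proof -
    have "continuous_on ({exp (- h)..1} \<union> {1..exp h}) (\<lambda>R. if R \<le> 1 then (R\<^sup>2 - 1) / 2 else ln R)"
      by (intro continuous_on_If) (auto intro!: continuous_intros)
    moreover have "disc_log = (\<lambda>R. if R \<le> 1 then (R\<^sup>2 - 1) / 2 else ln R)"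
      by (auto simp: disc_log_def fun_eq_iff)
    ultimately have "continuous_on ({exp (- h)..1} \<union> {1..exp h}) disc_log" by metis
    then show ?thesis by (rule continuous_on_subset) auto
  qed
  have "((\<lambda>r. r * disc_log r) has_integral (F (exp h) - F (exp (- h)))) {exp (- h)..exp h}"
  proof (rule fundamental_theorem_of_calculus_interior_strong[of "{1}"])
    have "continuous_on ({exp (- h)..1} \<union> {1..exp h}) F"
      unfolding F_def by (intro continuous_on_If) (auto intro!: continuous_intros)
    then show "continuous_on {exp (- h)..exp h} F"
      by (rule continuous_on_subset) auto
    fix r assume r: "r \<in> {exp (- h)<..<exp h} - {1}"
    then have "r > 0" using exp_gt_zero[of "- h"] by (auto simp del: exp_gt_zero)
    show "(F has_vector_derivative r * disc_log r) (at r)"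
    proof (cases "r < 1")
      case True
      have "((\<lambda>r. r ^ 4 / 8 - r\<^sup>2 / 4) has_real_derivative r * disc_log r) (at r)"
        using True by (auto intro!: derivative_eq_intros simp: disc_log_def field_simps power2_eq_square power3_eq_cube)
      then have "(F has_real_derivative r * disc_log r) (at r)"
        by (rule has_field_derivative_transform_within_open[where S = "{..<1}"]) (use True in \<open>auto simp: F_def\<close>)
      then show ?thesis by (simp add: has_real_derivative_iff_has_vector_derivative)
    next
      case False
      have "((\<lambda>r. r\<^sup>2 / 2 * ln r - r\<^sup>2 / 4 + 1 / 8) has_real_derivative r * disc_log r) (at r)"
        using \<open>r > 0\<close> False by (auto intro!: derivative_eq_intros simp: disc_log_def field_simps power2_eq_square)
      then have "(F has_real_derivative r * disc_log r) (at r)"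
        by (rule has_field_derivative_transform_within_open[where S = "{1<..}"]) (use False r in \<open>auto simp: F_def\<close>)
      then show ?thesis by (simp add: has_real_derivative_iff_has_vector_derivative)
    qed
  qed (use assms in auto)
  moreover have "(LINT r:{exp (- h)..exp h}|lborel. r * disc_log r) = integral {exp (- h)..exp h} (\<lambda>r. r * disc_log r)"
    by (intro set_borel_integral_eq_integral borel_integrable_atLeastAtMost' continuous_intros cdl)
  moreover have "F (exp h) - F (exp (- h)) = sector_integral h"
  proof (cases "h = 0")
    case True
    then show ?thesis by (simp add: F_def sector_integral_def)
  next
    case False
    then show ?thesis using assms
      by (simp add: F_def sector_integral_def exp_of_nat_mult[symmetric] field_simps flip: exp_double)
  qed
  ultimately show ?thesis by (simp add: integral_unique)
qed

text \<open>On the ray of slope t, a point at distance r has real part x = r / q with q = sqrt (1 +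
  t^2). The weight x dx thus becomes r dr / q^2, which yields the factor 1 / (1 + t^2); symmetry in
  t accounts for the 2.\<close>

lemma integral_disc_log_cball:
  "(LINT x:cball 0 1|lborel. disc_log (cmod (complex_of_real (sqrt 2) + x)))
    = 2 * integral {0..1} (\<lambda>t. sector_integral (arsinh (sqrt ((1 - t\<^sup>2) / (1 + t\<^sup>2)))) / (1 + t\<^sup>2))"
proof -
  let ?a = "complex_of_real (sqrt 2)"
  let ?h = "\<lambda>t::real. arsinh (sqrt ((1 - t\<^sup>2) / (1 + t\<^sup>2)))"
  let ?S = "\<lambda>t. sector_integral (?h t) / (1 + t\<^sup>2)"
  define f where "f w = indicator (cball ?a 1) w * disc_log (cmod w)" for w
  have [measurable]: "f \<in> borel_measurable borel" unfolding f_def[abs_def] by measurable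
  have s2: "sqrt 2 > 1" "sqrt 2 < 2" by (auto simp: real_less_lsqrt)
  \<comment> \<open>As sqrt 2 > 1, the disc lies in the open right half plane, the part of the plane
    covered by the slope coordinates.\<close>
  have Re_pos: "Re w > 0" if "w \<in> cball ?a 1" for w
  proof -
    have "\<bar>Re (?a - w)\<bar> \<le> 1"
      using that abs_Re_le_cmod[of "?a - w"] by (auto simp: dist_norm)
    then show ?thesis using s2(1) unfolding minus_complex.sel Re_complex_of_real by linarith
  qed
  have f_int: "integrable lborel f"
  proof (rule Bochner_Integration.integrable_bound)
    show "integrable lborel (\<lambda>w. 3 * indicator (cball ?a 1) w :: real)"
      using emeasure_lborel_cball_finite[of ?a 1] by (auto intro!: integrable_real_indicator simp: less_top)
    show "AE w in lborel. norm (f w) \<le> norm (3 * indicator (cball ?a 1) w :: real)"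
    proof (rule AE_I2)
      fix w
      show "norm (f w) \<le> norm (3 * indicator (cball ?a 1) w :: real)"
      proof (cases "w \<in> cball ?a 1")
        case True
        have "cmod w \<le> 3" using True norm_triangle_ineq2[of w ?a] s2
          by (auto simp: dist_norm norm_minus_commute)
        then show ?thesis using disc_log_ge[of "cmod w"] disc_log_le[of "cmod w"] True
          by (simp add: f_def)
      qed (simp add: f_def)
    qed
  qed simp
  define g where "g = (\<lambda>(t, x). (indicator {0<..} x * x) * f (Complex x (x * t)))"
  define M where "M = density (lborel \<Otimes>\<^sub>M lborel) (\<lambda>(t :: real, x). ennreal (indicator {0<..} x * x :: real))"
  have M: "density lborel (\<lambda>z. ennreal (indicator {0<..} (Re z))) = distr M borel (\<lambda>(t, x). Complex x (x * t))"
    using half_plane_polar by (simp add: M_def ennreal_indicator)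
  have [measurable]: "(\<lambda>(t, x). Complex x (x * t)) \<in> borel_measurable M"
    unfolding M_def by measurable
  have fRe: "indicator {0<..} (Re w) *\<^sub>R f w = f w" for w
    using Re_pos[of w] by (auto simp: f_def indicator_def)
  have g_alt: "g = (\<lambda>p. (case p of (t, x) \<Rightarrow> indicator {0<..} x * x) *\<^sub>R f (case p of (t, x) \<Rightarrow> Complex x (x * t)))"
    by (auto simp: g_def fun_eq_iff)
  have M': "M = density (lborel \<Otimes>\<^sub>M lborel) (\<lambda>p. ennreal (case p of (t, x) \<Rightarrow> indicator {0<..} x * x))"
    unfolding M_def by (intro arg_cong2[where f = density]) auto
  have g_int: "integrable (lborel \<Otimes>\<^sub>M lborel) g"
  proof -
    have "integrable (density lborel (\<lambda>z. ennreal (indicator {0<..} (Re z)))) f"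
      by (subst integrable_density) (auto simp: f_int fRe simp del: real_scaleR_def)
    then have "integrable M (\<lambda>p. f (case p of (t, x) \<Rightarrow> Complex x (x * t)))"
      unfolding M by (subst (asm) integrable_distr_eq) auto
    then show ?thesis
      unfolding M' g_alt by (subst (asm) integrable_density) (auto simp: indicator_def split: if_splits intro!: AE_I2)
  qed
  have "(LINT x:cball 0 1|lborel. disc_log (cmod (?a + x))) = (\<integral>x. f (?a + x) \<partial>lborel)"
    unfolding set_lebesgue_integral_def f_def
    by (intro Bochner_Integration.integral_cong) (auto simp: indicator_def dist_norm)
  also have "\<dots> = (\<integral>w. f w \<partial>distr lborel borel ((+) ?a))"
    by (rule integral_distr[symmetric]) auto
  also have "\<dots> = (\<integral>w. indicator {0<..} (Re w) *\<^sub>R f w \<partial>lborel)"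
    by (simp only: fRe lborel_distr_plus)
  also have "\<dots> = (\<integral>w. f w \<partial>density lborel (\<lambda>z. ennreal (indicator {0<..} (Re z))))"
    by (rule integral_density[symmetric]) auto
  also have "\<dots> = (\<integral>p. f (case p of (t, x) \<Rightarrow> Complex x (x * t)) \<partial>M)"
    unfolding M by (rule integral_distr) auto
  also have "\<dots> = (\<integral>p. g p \<partial>(lborel \<Otimes>\<^sub>M lborel))"
    unfolding M' g_alt by (rule integral_density) (auto simp: indicator_def split: if_splits intro!: AE_I2)
  also have "\<dots> = (\<integral>t. \<integral>x. g (t, x) \<partial>lborel \<partial>lborel)"
    by (rule lborel_pair.integral_fst'[OF g_int, symmetric])
  also have "\<dots> = (\<integral>t. indicator {-1..1} t *\<^sub>R ?S t \<partial>lborel)"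
  proof (rule Bochner_Integration.integral_cong)
    fix t :: real
    define q where "q = sqrt (1 + t\<^sup>2)"
    have q: "q > 0" "q\<^sup>2 = 1 + t\<^sup>2" unfolding q_def by (auto simp: add_pos_nonneg)
    have norm_q: "cmod (Complex (r / q) (r / q * t)) = r" if "r > 0" for r
    proof -
      have "(r / q)\<^sup>2 + (r / q * t)\<^sup>2 = (r / q)\<^sup>2 * (1 + t\<^sup>2)" by (simp only: power_mult_distrib distrib_left mult_1_right)
      also have "\<dots> = r\<^sup>2" using q by (simp add: power_divide flip: q(2))
      finally show ?thesis using that by (simp add: cmod_def)
    qed
    \<comment> \<open>The constant term 2 - 1 = 1 makes the roots of the quadratic reciprocal; half
      their sum is sqrt 2 / q.\<close>
    have mem: "Complex (r / q) (r / q * t) \<in> cball ?a 1 \<longleftrightarrow> r\<^sup>2 - 2 * (sqrt 2 / q) * r + 1 \<le> 0" if "r > 0" for r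
    proof -
      have *: "(dist ?a (Complex (r / q) (r / q * t)))\<^sup>2 = r\<^sup>2 - 2 * (sqrt 2 / q) * r + 2"
        (is "?d\<^sup>2 = _")
      proof -
        have "?d\<^sup>2 = (sqrt 2 - r / q)\<^sup>2 + (r / q * t)\<^sup>2"
          by (simp add: dist_norm cmod_def power2_commute)
        also have "\<dots> = (cmod (Complex (r / q) (r / q * t)))\<^sup>2 - 2 * (sqrt 2 / q) * r + 2"
          by (simp add: cmod_def power2_diff)
        finally show ?thesis using norm_q[OF that] by simp
      qed
      have "?d \<le> 1 \<longleftrightarrow> ?d\<^sup>2 \<le> 1\<^sup>2"
        by (rule abs_le_square_iff[of ?d 1, simplified abs_of_nonneg[OF zero_le_dist] abs_one])
      also have "\<dots> \<longleftrightarrow> r\<^sup>2 - 2 * (sqrt 2 / q) * r + 1 \<le> 0"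
        unfolding * by (simp add: add.commute)
      finally show ?thesis by (simp only: mem_cball)
    qed
    have "(\<integral>x. g (t, x) \<partial>lborel) = (1 / q) * (\<integral>r. g (t, r / q) \<partial>lborel)"
      using q lborel_integral_real_affine[of "1 / q" "\<lambda>x. g (t, x)" 0] by simp
    also have "(\<integral>r. g (t, r / q) \<partial>lborel)
       = (\<integral>r. (1 / q) * (indicator {r. 0 < r \<and> r\<^sup>2 - 2 * (sqrt 2 / q) * r + 1 \<le> 0} r * (r * disc_log r)) \<partial>lborel)"
    proof (rule Bochner_Integration.integral_cong)
      fix r :: real
      show "g (t, r / q) = (1 / q) * (indicator {r. 0 < r \<and> r\<^sup>2 - 2 * (sqrt 2 / q) * r + 1 \<le> 0} r * (r * disc_log r))"
        using q mem[of r] norm_q[of r] by (cases "r > 0") (auto simp: g_def f_def indicator_def zero_less_divide_iff)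
    qed simp
    also have "\<dots> = (1 / q) * (\<integral>r. indicator {r. 0 < r \<and> r\<^sup>2 - 2 * (sqrt 2 / q) * r + 1 \<le> 0} r * (r * disc_log r) \<partial>lborel)"
      by simp
    finally have 1: "(\<integral>x. g (t, x) \<partial>lborel)
       = (1 / q\<^sup>2) * (\<integral>r. indicator {r. 0 < r \<and> r\<^sup>2 - 2 * (sqrt 2 / q) * r + 1 \<le> 0} r * (r * disc_log r) \<partial>lborel)"
      by (simp add: power2_eq_square)
    show "(\<integral>x. g (t, x) \<partial>lborel) = indicator {-1..1} t *\<^sub>R ?S t"
    proof (cases "\<bar>t\<bar> \<le> 1")
      case True
      then have "t\<^sup>2 \<le> 1" by (simp add: abs_square_le_1)
      have h0: "?h t \<ge> 0" using \<open>t\<^sup>2 \<le> 1\<close>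
        by (metis arsinh_0 arsinh_real_neg_iff diff_ge_0_iff_ge divide_nonneg_nonneg linorder_not_le
            real_sqrt_ge_zero add_nonneg_nonneg zero_le_one zero_le_power2)
      \<comment> \<open>This matches cosh h with half the sum of the roots, so the roots are exp h
        and exp (-h).\<close>
      have "cosh (?h t) = sqrt 2 / q"
      proof -
        have *: "(1 - t\<^sup>2) / (1 + t\<^sup>2) + 1 = 2 / (1 + t\<^sup>2)"
          using q by (simp add: field_simps add_pos_nonneg)
        have "0 \<le> (1 - t\<^sup>2) / (1 + t\<^sup>2)" using \<open>t\<^sup>2 \<le> 1\<close> by simp
        then show ?thesis
          unfolding cosh_arsinh_real q_def by (simp only: real_sqrt_pow2 *) (rule real_sqrt_divide)
      qed
      then have k: "2 * (sqrt 2 / q) = exp (?h t) + exp (- ?h t)" by (simp add: cosh_def)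
      have S: "{r. 0 < r \<and> r\<^sup>2 - 2 * (sqrt 2 / q) * r + 1 \<le> 0} = {exp (- ?h t)..exp (?h t)}"
      proof -
        have *: "r\<^sup>2 - 2 * (sqrt 2 / q) * r + 1 = (r - exp (- ?h t)) * (r - exp (?h t))" for r
          unfolding k by (simp add: power2_eq_square algebra_simps flip: exp_add)
        have "exp (- ?h t) \<le> exp (?h t)" using h0 by simp
        moreover have "r > 0" if "exp (- ?h t) \<le> r" for r
          using that exp_gt_zero[of "- ?h t"] by linarith
        moreover have "(r - a) * (r - b) \<le> 0 \<longleftrightarrow> a \<le> r \<and> r \<le> b" if "a \<le> b" for a b r :: real
          using that unfolding mult_le_0_iff by linarith
        ultimately show ?thesis unfolding * by auto
      qed
      have I: "(\<integral>r. indicator {exp (- ?h t)..exp (?h t)} r * (r * disc_log r) \<partial>lborel) = sector_integral (?h t)"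
        using integral_disc_log[OF h0] by (simp only: set_lebesgue_integral_def real_scaleR_def)
      have "t \<in> {-1..1}" using True by auto
      then show ?thesis unfolding 1 S I q(2) by simp
    next
      case False
      then have "t\<^sup>2 > 1" using abs_square_le_1[of t] by linarith
      then have "q\<^sup>2 > 2" using q by simp
      then have "sqrt 2 < q" using q(1) real_less_lsqrt by force
      then have k: "sqrt 2 / q < 1" using q by simp
      \<comment> \<open>For |t| > 1 the ray misses the disc: as sqrt 2 / q < 1, the quadratic
        exceeds (r - 1)^2.\<close>
      have "0 < r\<^sup>2 - 2 * (sqrt 2 / q) * r + 1" if "r > 0" for r
      proof -
        have "(sqrt 2 / q) * r < 1 * r" by (rule mult_strict_right_mono[OF k that])
        moreover have "0 \<le> (r - 1)\<^sup>2" by simp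
        ultimately show ?thesis by (simp add: power2_diff)
      qed
      then have S: "{r. 0 < r \<and> r\<^sup>2 - 2 * (sqrt 2 / q) * r + 1 \<le> 0} = {}" by force
      have "t \<notin> {-1..1}" using False by auto
      then show ?thesis unfolding 1 S by simp
    qed
  qed simp
  also have "\<dots> = integral {-1..1} ?S"
  proof -
    have "continuous_on {-1..1} ?S"
      unfolding sector_integral_def
      by (intro continuous_intros) (auto simp: one_plus_square)
    then have "set_integrable lborel {-1..1} ?S" by (rule borel_integrable_atLeastAtMost')
    from set_borel_integral_eq_integral(2)[OF this] show ?thesis
      by (simp add: set_lebesgue_integral_def)
  qed
  also have "\<dots> = 2 * integral {0..1} ?S"
  proof -
    have c: "continuous_on A ?S" for A
      unfolding sector_integral_def
      by (intro continuous_intros) (auto simp: one_plus_square)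
    have "integral {-1..1} ?S = integral {-1..0} ?S + integral {0..1} ?S"
      by (rule Henstock_Kurzweil_Integration.integral_combine[symmetric]) (auto intro!: integrable_continuous_real c)
    also have "integral {-1..0} ?S = integral {0..1} ?S"
      using Henstock_Kurzweil_Integration.integral_reflect_real[of 1 0 ?S] by (simp only: power2_minus minus_zero)
    finally show ?thesis by simp
  qed
  finally show ?thesis .
qed

theorem theorem1p2:
  shows "areal_mahler2 (\<lambda>x y. complex_of_real (sqrt 2) + x + y)
           = L_chi_m4 2 / pi + C_sqrt2 + 3/8 - 3 / (2 * pi)"
proof -
  have "sqrt 2 \<le> 2" by (rule real_le_lsqrt) auto
  then have "areal_mahler2 (\<lambda>x y. complex_of_real (sqrt 2) + x + y)
      = (1 / pi) * (LINT x:cball 0 1|lborel. disc_log (cmod (complex_of_real (sqrt 2) + x)))"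
    by (intro areal_mahler2_translate_add) auto
  also have "\<dots> = (1 / pi) * (pi * C_sqrt2 + L_chi_m4 2 + 3 * pi / 8 - 3 / 2)"
    unfolding integral_disc_log_cball integral_sector_integral C_sqrt2_eq L_chi_m4_2 ..
  also have "\<dots> = L_chi_m4 2 / pi + C_sqrt2 + 3/8 - 3 / (2 * pi)"
    by (simp add: field_simps)
  finally show ?thesis .
qed

end
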